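(* For every $n\ge1$, $E_{\min}(\omega^n+1)\ \not\le_c\ \cong_{\mathcal{CM}_n}$.
   Context: $W_e$ denotes the $e$-th c.e. set. $\mathcal{CM}$ is the variety of commutative monoids. For $n\ge1$, $X_n=\{x_0,\dots,x_{n-1}\}$; fix a computable bijective coding of pairs of terms over $X_n$ by natural numbers. $\mathcal{CM}_n[e]$ is the term algebra over $X_n$ modulo the smallest congruence containing the pairs coded in $W_e$ and all instances of the commutative monoid laws; $e\cong_{\mathcal{CM}_n}i$ iff $\mathcal{CM}_n[e]\cong\mathcal{CM}_n[i]$. For an ordinal $\alpha\le\omega^\omega$, fix a computable bijection $h$ from the ordinals $<\alpha$ (Cantor normal forms coded as finite tuples of naturals) onto $\mathbb N$, let $n\le_\alpha m$ iff $h^{-1}(n)\le h^{-1}(m)$, and let $e\,E_{\min}(\alpha)\,i$ iff $W_e,W_i$ are both empty or have the same $\le_\alpha$-least element. $E\le_c F$ means there is a total computable $h$ with $x\,E\,y\iff h(x)\,F\,h(y)$. *)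

theory Defs
  imports "HOL-Library.Nat_Bijection" "HOL-Algebra.Group"
begin

text \<open>
  Programs for the unary partial recursive functions; further arguments are passed through the
  pairing bijection \<^const>\<open>prod_encode\<close>. \<open>Prec\<close> is primitive recursion in the second component of
  its argument, and \<open>Mu\<close> is unbounded search, which diverges if a value needed along the way does.
\<close>

datatype prog =
    Zero | Succ | Fst | Snd
  | Pair prog prog
  | Comp prog prog
  | Prec prog prog
  | Mu prog

primrec run :: "prog \<Rightarrow> nat \<Rightarrow> nat option" where
  "run Zero x = Some 0"
| "run Succ x = Some (Suc x)"
| "run Fst x = Some (fst (prod_decode x))"
| "run Snd x = Some (snd (prod_decode x))"
| "run (Pair p q) x =
     Option.bind (run p x) (\<lambda>a. Option.bind (run q x) (\<lambda>b. Some (prod_encode (a, b))))"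
| "run (Comp p q) x = Option.bind (run q x) (run p)"
| "run (Prec p q) x =
     (case prod_decode x of (a, n) \<Rightarrow>
       rec_nat (run p a)
         (\<lambda>k r. Option.bind r (\<lambda>v. run q (prod_encode (a, prod_encode (k, v))))) n)"
| "run (Mu p) x =
     (if \<exists>n. run p (prod_encode (x, n)) = Some 0
           \<and> (\<forall>k<n. run p (prod_encode (x, k)) \<noteq> None)
      then Some (LEAST n. run p (prod_encode (x, n)) = Some 0)
      else None)"

primrec prog_code :: "prog \<Rightarrow> nat" where
  "prog_code Zero = 0"
| "prog_code Succ = 1"
| "prog_code Fst = 2"
| "prog_code Snd = 3"
| "prog_code (Pair p q) = 4 + 4 * prod_encode (prog_code p, prog_code q)"
| "prog_code (Comp p q) = 5 + 4 * prod_encode (prog_code p, prog_code q)"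
| "prog_code (Prec p q) = 6 + 4 * prod_encode (prog_code p, prog_code q)"
| "prog_code (Mu p) = 7 + 4 * prog_code p"

lemma inj_prog_code: "inj prog_code"
proof (rule injI)
  fix p q :: prog
  show "prog_code p = prog_code q \<Longrightarrow> p = q"
  proof (induction p arbitrary: q)
    case (Pair p1 p2) then show ?case by (cases q) (auto, presburger+)
  next
    case (Comp p1 p2) then show ?case by (cases q) (auto, presburger+)
  next
    case (Prec p1 p2) then show ?case by (cases q) (auto, presburger+)
  next
    case (Mu p) then show ?case by (cases q) (auto, presburger+)
  qed (case_tac q; simp)+
qed

lemma bij_prog_code: "bij prog_code"
proof -
  have "\<exists>p. prog_code p = k" for k
  proof (induction k rule: less_induct)
    case (less k)
    show ?case
    proof (cases "k < 4")
      case True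
      then have "k = prog_code Zero \<or> k = prog_code Succ \<or> k = prog_code Fst \<or> k = prog_code Snd"
        by auto
      then show ?thesis by blast
    next
      case False
      define d r where "d = (k - 4) div 4" and "r = (k - 4) mod 4"
      have k: "k = 4 + 4 * d + r" and r: "r < 4"
        using False unfolding d_def r_def by simp_all
      obtain a b where d: "d = prod_encode (a, b)"
        by (metis prod.exhaust prod_decode_inverse)
      have "a < k" "b < k" "d < k"
        using k le_prod_encode_1[of a b] le_prod_encode_2[of b a] unfolding d by linarith+
      then obtain p q s where
        pq: "prog_code p = a" "prog_code q = b" "prog_code s = d"
        using less by metis
      consider "r = 0" | "r = 1" | "r = 2" | "r = 3" using r by linarith
      then show ?thesis
      proof cases
        case 1 with k d pq show ?thesis by (intro exI[of _ "Pair p q"]) simp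
      next
        case 2 with k d pq show ?thesis by (intro exI[of _ "Comp p q"]) simp
      next
        case 3 with k d pq show ?thesis by (intro exI[of _ "Prec p q"]) simp
      next
        case 4 with k pq show ?thesis by (intro exI[of _ "Mu s"]) simp
      qed
    qed
  qed
  then show ?thesis by (metis bijI inj_prog_code surjI surj_def)
qed

definition phi :: "nat \<Rightarrow> nat \<Rightarrow> nat option" where
  "phi e = run (inv_into UNIV prog_code e)"

definition W :: "nat \<Rightarrow> nat set" where
  "W e = {x. phi e x \<noteq> None}"

definition computable :: "(nat \<Rightarrow> nat) \<Rightarrow> bool" where
  "computable f \<longleftrightarrow> (\<exists>p. \<forall>x. run p x = Some (f x))"

definition creducible :: "(nat \<Rightarrow> nat \<Rightarrow> bool) \<Rightarrow> (nat \<Rightarrow> nat \<Rightarrow> bool) \<Rightarrow> bool"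
    (infix \<open>\<le>\<^sub>c\<close> 50) where
  "E \<le>\<^sub>c F \<longleftrightarrow> (\<exists>h. computable h \<and> (\<forall>x y. E x y \<longleftrightarrow> F (h x) (h y)))"

datatype trm = Var nat | Unit | Times trm trm

primrec vars :: "trm \<Rightarrow> nat set" where
  "vars (Var i) = {i}"
| "vars Unit = {}"
| "vars (Times s t) = vars s \<union> vars t"

definition terms :: "nat \<Rightarrow> trm set" where
  "terms n = {t. vars t \<subseteq> {..<n}}"

text \<open>The coding depends on \<open>n\<close>, so that it maps the terms over \<open>X\<^sub>n\<close> onto the natural numbers.\<close>

primrec term_code :: "nat \<Rightarrow> trm \<Rightarrow> nat" where
  "term_code n Unit = 0"
| "term_code n (Var i) = Suc i"
| "term_code n (Times s t) = Suc n + prod_encode (term_code n s, term_code n t)"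

lemma terms_simps [simp]:
  "Unit \<in> terms n" "Var i \<in> terms n \<longleftrightarrow> i < n"
  "Times s t \<in> terms n \<longleftrightarrow> s \<in> terms n \<and> t \<in> terms n"
  by (auto simp: terms_def)

lemma bij_betw_term_code: "bij_betw (term_code n) (terms n) UNIV"
proof (rule bij_betw_imageI)
  show "inj_on (term_code n) (terms n)"
  proof (rule inj_onI)
    fix s t show "s \<in> terms n \<Longrightarrow> t \<in> terms n \<Longrightarrow> term_code n s = term_code n t \<Longrightarrow> s = t"
    proof (induction s arbitrary: t)
      case (Var i) then show ?case by (cases t) auto
    next
      case Unit then show ?case by (cases t) auto
    next
      case (Times s1 s2) then show ?case by (cases t) auto
    qed
  qed
  have "\<exists>t\<in>terms n. term_code n t = k" for k
  proof (induction k rule: less_induct)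
    case (less k)
    consider "k = 0" | i where "k = Suc i" "i < n" | d where "k = Suc n + d"
      by (metis Suc_leI less_Suc_eq_0_disj less_iff_Suc_add linorder_not_less nat_le_iff_add)
    then show ?case
    proof cases
      case 1 then show ?thesis by (intro bexI[of _ Unit]) auto
    next
      case (2 i) then show ?thesis by (intro bexI[of _ "Var i"]) auto
    next
      case (3 d)
      obtain a b where d: "d = prod_encode (a, b)"
        by (metis prod.exhaust prod_decode_inverse)
      have "a < k" "b < k"
        using 3 d le_prod_encode_1[of a b] le_prod_encode_2[of b a] by auto
      then obtain s t where "s \<in> terms n" "t \<in> terms n" "term_code n s = a" "term_code n t = b"
        using less by metis
      then show ?thesis using 3 d by (intro bexI[of _ "Times s t"]) auto
    qed
  qed
  then show "term_code n ` terms n = UNIV" by (auto simp: image_iff set_eq_iff) metis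
qed

definition coded_pairs :: "nat \<Rightarrow> nat set \<Rightarrow> (trm \<times> trm) set" where
  "coded_pairs n A =
     {(s, t) \<in> terms n \<times> terms n. prod_encode (term_code n s, term_code n t) \<in> A}"

inductive_set cm_congruence :: "nat \<Rightarrow> (trm \<times> trm) set \<Rightarrow> (trm \<times> trm) set"
  for n :: nat and R :: "(trm \<times> trm) set" where
  base: "(s, t) \<in> R \<Longrightarrow> s \<in> terms n \<Longrightarrow> t \<in> terms n \<Longrightarrow> (s, t) \<in> cm_congruence n R"
| assoc: "r \<in> terms n \<Longrightarrow> s \<in> terms n \<Longrightarrow> t \<in> terms n \<Longrightarrow>
    (Times (Times r s) t, Times r (Times s t)) \<in> cm_congruence n R"
| comm: "s \<in> terms n \<Longrightarrow> t \<in> terms n \<Longrightarrow> (Times s t, Times t s) \<in> cm_congruence n R"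
| unit: "t \<in> terms n \<Longrightarrow> (Times Unit t, t) \<in> cm_congruence n R"
| refl: "t \<in> terms n \<Longrightarrow> (t, t) \<in> cm_congruence n R"
| sym: "(s, t) \<in> cm_congruence n R \<Longrightarrow> (t, s) \<in> cm_congruence n R"
| trans: "(r, s) \<in> cm_congruence n R \<Longrightarrow> (s, t) \<in> cm_congruence n R \<Longrightarrow>
    (r, t) \<in> cm_congruence n R"
| times: "(s, s') \<in> cm_congruence n R \<Longrightarrow> (t, t') \<in> cm_congruence n R \<Longrightarrow>
    (Times s t, Times s' t') \<in> cm_congruence n R"

definition CM_alg :: "nat \<Rightarrow> nat \<Rightarrow> trm set monoid" where
  "CM_alg n e = (let C = cm_congruence n (coded_pairs n (W e)) in
     \<lparr>carrier = terms n // C,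
      mult = (\<lambda>A B. \<Union>s\<in>A. \<Union>t\<in>B. C `` {Times s t}),
      one = C `` {Unit}\<rparr>)"

lemma cm_congruence_terms:
  "(s, t) \<in> cm_congruence n R \<Longrightarrow> s \<in> terms n \<and> t \<in> terms n"
  by (induction rule: cm_congruence.induct) auto

lemma equiv_cm_congruence: "equiv (terms n) (cm_congruence n R)"
  by (intro equivI refl_onI symI transI subsetI)
     (auto dest: cm_congruence_terms intro: cm_congruence.refl cm_congruence.sym cm_congruence.trans)

lemma CM_alg_mult:
  fixes n e :: nat
  assumes "s \<in> terms n" "t \<in> terms n"
  defines "C \<equiv> cm_congruence n (coded_pairs n (W e))"
  shows "C `` {s} \<otimes>\<^bsub>CM_alg n e\<^esub> C `` {t} = C `` {Times s t}"
proof -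
  have "C `` {Times s' t'} = C `` {Times s t}" if "(s, s') \<in> C" "(t, t') \<in> C" for s' t'
    using that unfolding C_def
    by (intro equiv_class_eq[OF equiv_cm_congruence] cm_congruence.sym[OF cm_congruence.times])
  moreover have "s \<in> C `` {s}" "t \<in> C `` {t}"
    using assms by (simp_all add: C_def cm_congruence.refl)
  ultimately have "(\<Union>s'\<in>C `` {s}. \<Union>t'\<in>C `` {t}. C `` {Times s' t'}) = C `` {Times s t}"
    by blast
  then show ?thesis by (simp add: CM_alg_def Let_def C_def)
qed

lemma comm_monoid_CM_alg: "comm_monoid (CM_alg n e)"
proof -
  define C where "C = cm_congruence n (coded_pairs n (W e))"
  have eqI: "C `` {s} = C `` {t}" if "(s, t) \<in> cm_congruence n (coded_pairs n (W e))" for s t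
    using that unfolding C_def by (rule equiv_class_eq[OF equiv_cm_congruence])
  have car: "A \<in> carrier (CM_alg n e) \<longleftrightarrow> (\<exists>s\<in>terms n. A = C `` {s})" for A
    by (auto simp: CM_alg_def Let_def C_def quotient_def)
  have one: "\<one>\<^bsub>CM_alg n e\<^esub> = C `` {Unit}"
    by (simp add: CM_alg_def Let_def C_def)
  note mult = CM_alg_mult[of _ n _ e, folded C_def]
  show ?thesis
  proof (rule comm_monoidI)
    fix x y assume "x \<in> carrier (CM_alg n e)" "y \<in> carrier (CM_alg n e)"
    then obtain s t where st: "s \<in> terms n" "t \<in> terms n" "x = C `` {s}" "y = C `` {t}"
      using car by auto
    then show "x \<otimes>\<^bsub>CM_alg n e\<^esub> y \<in> carrier (CM_alg n e)"
      unfolding car by (intro bexI[of _ "Times s t"]) (simp_all add: mult)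
    show "x \<otimes>\<^bsub>CM_alg n e\<^esub> y = y \<otimes>\<^bsub>CM_alg n e\<^esub> x"
      using st eqI[OF cm_congruence.comm] by (simp add: mult)
  next
    show "\<one>\<^bsub>CM_alg n e\<^esub> \<in> carrier (CM_alg n e)" unfolding car one by (intro bexI[of _ Unit]) simp_all
  next
    fix x y z assume "x \<in> carrier (CM_alg n e)" "y \<in> carrier (CM_alg n e)"
      "z \<in> carrier (CM_alg n e)"
    then obtain r s t where st: "r \<in> terms n" "s \<in> terms n" "t \<in> terms n"
        "x = C `` {r}" "y = C `` {s}" "z = C `` {t}"
      unfolding car by blast
    have "C `` {Times (Times r s) t} = C `` {Times r (Times s t)}"
      using st by (intro eqI cm_congruence.assoc)
    then show "x \<otimes>\<^bsub>CM_alg n e\<^esub> y \<otimes>\<^bsub>CM_alg n e\<^esub> z = x \<otimes>\<^bsub>CM_alg n e\<^esub> (y \<otimes>\<^bsub>CM_alg n e\<^esub> z)"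
      using st by (simp add: mult)
  next
    fix x assume "x \<in> carrier (CM_alg n e)"
    then obtain t where st: "t \<in> terms n" "x = C `` {t}" using car by auto
    have "C `` {Times Unit t} = C `` {t}"
      using st by (intro eqI cm_congruence.unit)
    then show "\<one>\<^bsub>CM_alg n e\<^esub> \<otimes>\<^bsub>CM_alg n e\<^esub> x = x" using st by (simp add: one mult)
  qed
qed

text \<open>
  \<^const>\<open>iso\<close> only demands compatibility with multiplication; between monoids this already forces
  compatibility with the constant \<open>1\<close>.
\<close>

lemma iso_CM_alg_one:
  assumes "h \<in> iso (CM_alg n e) (CM_alg n i)"
  shows "h \<one>\<^bsub>CM_alg n e\<^esub> = \<one>\<^bsub>CM_alg n i\<^esub>"
proof -
  interpret G: comm_monoid "CM_alg n e" by (rule comm_monoid_CM_alg)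
  interpret H: comm_monoid "CM_alg n i" by (rule comm_monoid_CM_alg)
  from assms have hom: "h \<in> hom (CM_alg n e) (CM_alg n i)"
    and bij: "bij_betw h (carrier (CM_alg n e)) (carrier (CM_alg n i))"
    by (auto simp: iso_def)
  obtain x where x: "x \<in> carrier (CM_alg n e)" "h x = \<one>\<^bsub>CM_alg n i\<^esub>"
    using bij H.one_closed by (metis bij_betw_imp_surj_on imageE)
  have "h \<one>\<^bsub>CM_alg n e\<^esub> = h \<one>\<^bsub>CM_alg n e\<^esub> \<otimes>\<^bsub>CM_alg n i\<^esub> h x"
    using hom_in_carrier[OF hom G.one_closed] by (simp add: x)
  also have "\<dots> = h (\<one>\<^bsub>CM_alg n e\<^esub> \<otimes>\<^bsub>CM_alg n e\<^esub> x)"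
    using hom_mult[OF hom G.one_closed x(1)] by simp
  also have "\<dots> = \<one>\<^bsub>CM_alg n i\<^esub>" using x by simp
  finally show ?thesis .
qed

definition CM_iso :: "nat \<Rightarrow> nat \<Rightarrow> nat \<Rightarrow> bool" where
  "CM_iso n e i \<longleftrightarrow> CM_alg n e \<cong> CM_alg n i"

text \<open>
  The list \<open>[c\<^sub>k, \<dots>, c\<^sub>0]\<close> with \<open>c\<^sub>k > 0\<close> stands for
  \<open>\<omega>\<^sup>k \<cdot> c\<^sub>k + \<dots> + \<omega> \<cdot> c\<^sub>1 + c\<^sub>0\<close>, and the empty list for \<open>0\<close>.
\<close>

definition cnf :: "nat list \<Rightarrow> bool" where
  "cnf a \<longleftrightarrow> a = [] \<or> hd a > 0"

definition ord_less :: "nat list \<Rightarrow> nat list \<Rightarrow> bool" where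
  "ord_less a b \<longleftrightarrow> (a, b) \<in> lenlex less_than"

definition ord_below :: "nat list \<Rightarrow> nat list set" where
  "ord_below a = {b. cnf b \<and> ord_less b a}"

definition omega_pow :: "nat \<Rightarrow> nat list" where
  "omega_pow n = 1 # replicate n 0"

definition ord_succ :: "nat list \<Rightarrow> nat list" where
  "ord_succ a = (if a = [] then [1] else butlast a @ [Suc (last a)])"

lemma ord_below_omega_pow: "ord_below (omega_pow n) = {b. cnf b \<and> length b \<le> n}"
proof -
  have "cnf b \<Longrightarrow> length b = Suc n \<Longrightarrow> (b, 1 # replicate n 0) \<notin> lex less_than" for b
  proof -
    have *: "length c = m \<Longrightarrow> (c, replicate m 0) \<notin> lex less_than" for c :: "nat list" and m
      by (induction m arbitrary: c) (auto simp: length_Suc_conv)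
    show "cnf b \<Longrightarrow> length b = Suc n \<Longrightarrow> (b, 1 # replicate n 0) \<notin> lex less_than"
      using * by (cases b) (auto simp: cnf_def)
  qed
  then show ?thesis
    by (auto simp: ord_below_def ord_less_def omega_pow_def lenlex_conv less_Suc_eq_le)
qed

lemma ord_below_succ:
  assumes "cnf a"
  shows "ord_below (ord_succ a) = insert a (ord_below a)"
proof -
  have *: "(b, c @ [Suc x]) \<in> lex less_than \<longleftrightarrow> b = c @ [x] \<or> (b, c @ [x]) \<in> lex less_than"
    if "length b = Suc (length c)" for b c :: "nat list" and x
    using that
  proof (induction c arbitrary: b)
    case Nil
    then show ?case by (auto simp: length_Suc_conv)
  next
    case (Cons y c)
    then obtain z d where "b = z # d" "length d = Suc (length c)"
      by (auto simp: length_Suc_conv)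
    then show ?case using Cons.IH[of d] by auto
  qed
  show ?thesis
  proof (cases a rule: rev_cases)
    case Nil
    have "cnf b \<Longrightarrow> length b = 1 \<Longrightarrow> (b, [1]) \<notin> lex less_than" for b
      by (auto simp: cnf_def length_Suc_conv)
    then show ?thesis using Nil
      by (auto simp: ord_below_def ord_succ_def ord_less_def lenlex_conv cnf_def less_Suc_eq)
  next
    case (snoc c x)
    then show ?thesis using assms *
      by (auto simp: ord_below_def ord_succ_def ord_less_def lenlex_conv)
  qed
qed

definition computable_coding :: "nat list \<Rightarrow> (nat list \<Rightarrow> nat) \<Rightarrow> bool" where
  "computable_coding a h \<longleftrightarrow> bij_betw h (ord_below a) UNIV \<and>
     (\<exists>f. computable f \<and> (\<forall>b\<in>ord_below a. h b = f (list_encode b)))"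

definition coded_le :: "nat list \<Rightarrow> (nat list \<Rightarrow> nat) \<Rightarrow> nat \<Rightarrow> nat \<Rightarrow> bool" where
  "coded_le a h k m \<longleftrightarrow>
     (let b = inv_into (ord_below a) h k; c = inv_into (ord_below a) h m
      in b = c \<or> ord_less b c)"

definition least_elem :: "nat list \<Rightarrow> (nat list \<Rightarrow> nat) \<Rightarrow> nat set \<Rightarrow> nat \<Rightarrow> bool" where
  "least_elem a h A m \<longleftrightarrow> m \<in> A \<and> (\<forall>k\<in>A. coded_le a h m k)"

definition E_min :: "nat list \<Rightarrow> (nat list \<Rightarrow> nat) \<Rightarrow> nat \<Rightarrow> nat \<Rightarrow> bool" where
  "E_min a h e i \<longleftrightarrow> (W e = {} \<and> W i = {}) \<or>
     (\<exists>m. least_elem a h (W e) m \<and> least_elem a h (W i) m)"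

end

theory Submission
  imports Defs
begin

text \<open>
  Suppose that \<open>r\<close> is a reduction. For an ordinal \<open>\<beta> \<le> \<omega>\<^sup>n\<close> let \<open>M\<^sub>\<beta>\<close> be the monoid that
  \<open>r\<close> assigns to an index of \<open>{\<beta>}\<close>. It is finitely presented by Redei's theorem, so having a
  surjective homomorphism from \<open>M\<^sub>\<beta>\<close> is a c.e. property of indices. For \<open>\<gamma> < \<beta>\<close>, the recursion theorem
  yields an index \<open>e\<close> that enumerates \<open>\<beta>\<close>, and also \<open>\<gamma>\<close> once such a homomorphism onto
  the monoid of \<open>r e\<close> is found. One must be found, so \<open>M\<^sub>\<gamma>\<close> is a proper quotient of
  \<open>M\<^sub>\<beta>\<close>. In the same way, \<open>M\<close> for \<open>\<omega>\<^sup>n\<close> is a proper quotient of the monoid assigned to the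
  empty set.

  On the other hand, a congruence on \<open>\<nat>\<^sup>n\<close> determines the downset of the lexicographically least
  elements of its classes, and this downset shrinks strictly when the congruence grows. Descending
  by \<open>\<omega>\<^sup>k\<close> removes a translate of some \<open>k\<close>-dimensional orthant from the downset, so a
  downset belonging to \<open>\<omega>\<^sup>n\<close> is all of \<open>\<nat>\<^sup>n\<close>, which leaves no room for the empty set.
\<close>

section \<open>Computable functions and semidecidable sets\<close>

abbreviation pfst :: "nat \<Rightarrow> nat" where "pfst x \<equiv> fst (prod_decode x)"
abbreviation psnd :: "nat \<Rightarrow> nat" where "psnd x \<equiv> snd (prod_decode x)"

named_theorems computable_intros

lemma computable_id [computable_intros]: "computable (\<lambda>x. x)"
  unfolding computable_def by (rule exI[of _ "Pair Fst Snd"]) simp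

lemma computable_comp:
  assumes "computable f" "computable g" shows "computable (\<lambda>x. f (g x))"
proof -
  obtain p q where "\<forall>x. run p x = Some (f x)" "\<forall>x. run q x = Some (g x)"
    using assms unfolding computable_def by blast
  then show ?thesis unfolding computable_def by (intro exI[of _ "Comp p q"]) simp
qed

lemma computable_Suc [computable_intros]:
  "computable f \<Longrightarrow> computable (\<lambda>x. Suc (f x))"
  by (rule computable_comp[of Suc]) (auto simp: computable_def intro: exI[of _ Succ])

lemma computable_const [computable_intros]: "computable (\<lambda>x. c)"
proof (induction c)
  case 0 show ?case unfolding computable_def by (rule exI[of _ Zero]) simp
qed (rule computable_Suc)

lemma computable_pfst [computable_intros]:
  "computable f \<Longrightarrow> computable (\<lambda>x. pfst (f x))"
  by (rule computable_comp[of pfst]) (auto simp: computable_def intro: exI[of _ Fst])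

lemma computable_psnd [computable_intros]:
  "computable f \<Longrightarrow> computable (\<lambda>x. psnd (f x))"
  by (rule computable_comp[of psnd]) (auto simp: computable_def intro: exI[of _ Snd])

lemma computable_prod_encode [computable_intros]:
  assumes "computable f" "computable g" shows "computable (\<lambda>x. prod_encode (f x, g x))"
proof -
  obtain p q where "\<forall>x. run p x = Some (f x)" "\<forall>x. run q x = Some (g x)"
    using assms unfolding computable_def by blast
  then show ?thesis unfolding computable_def by (intro exI[of _ "Pair p q"]) simp
qed

text \<open>\<open>Prec\<close> is run on the pair of \<open>x\<close> and \<open>m x\<close>, so
  the whole argument \<open>x\<close> serves as its parameter and both \<open>a\<close> and
  \<open>b\<close> may depend on it.\<close>

lemma computable_rec_nat:
  assumes "computable a" "computable (\<lambda>x. b (pfst x) (pfst (psnd x)) (psnd (psnd x)))"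
    and "computable m"
  shows "computable (\<lambda>x. rec_nat (a x) (b x) (m x))"
proof -
  obtain p q where p: "\<forall>x. run p x = Some (a x)"
    and q: "\<forall>x. run q x = Some (b (pfst x) (pfst (psnd x)) (psnd (psnd x)))"
    using assms unfolding computable_def by blast
  have "rec_nat (Some (a x)) (\<lambda>k r. Option.bind r (\<lambda>v. run q (prod_encode (x, prod_encode (k, v))))) k
      = Some (rec_nat (a x) (b x) k)" for x k
    by (induction k) (simp_all add: q)
  then have "computable (\<lambda>y. rec_nat (a (pfst y)) (b (pfst y)) (psnd y))"
    unfolding computable_def by (intro exI[of _ "Prec p q"]) (simp add: p split: prod.split)
  from computable_comp[OF this, of "\<lambda>x. prod_encode (x, m x)"] show ?thesis
    using assms(3) by (simp add: computable_prod_encode computable_id)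
qed

lemma computable_case_nat:
  assumes "computable a" "computable (\<lambda>x. b (pfst x) (psnd x))" "computable m"
  shows "computable (\<lambda>x. case m x of 0 \<Rightarrow> a x | Suc k \<Rightarrow> b x k)"
proof -
  have "computable (\<lambda>x. rec_nat (a x) (\<lambda>k r. b x k) (m x))"
    using computable_comp[OF assms(2), of "\<lambda>x. prod_encode (pfst x, pfst (psnd x))"] assms
    by (intro computable_rec_nat)
       (simp_all add: computable_prod_encode computable_pfst computable_psnd computable_id)
  moreover have "rec_nat (a x) (\<lambda>k r. b x k) (m x) = (case m x of 0 \<Rightarrow> a x | Suc k \<Rightarrow> b x k)" for x
    by (cases "m x") auto
  ultimately show ?thesis by (simp only:)
qed

lemma computable_add [computable_intros]:
  assumes "computable f" "computable g" shows "computable (\<lambda>x. f x + g x)"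
proof -
  have "computable (\<lambda>x. rec_nat (f x) (\<lambda>k r. Suc r) (g x))"
    by (intro computable_rec_nat computable_intros assms)
  moreover have "rec_nat a (\<lambda>k r. Suc r) b = a + b" for a b by (induction b) auto
  ultimately show ?thesis by (simp only:)
qed

lemma computable_mult [computable_intros]:
  assumes "computable f" "computable g" shows "computable (\<lambda>x. f x * g x)"
proof -
  have "computable (\<lambda>x. rec_nat 0 (\<lambda>k r. r + f x) (g x))"
    using assms by (intro computable_rec_nat computable_intros computable_comp[OF assms(1)])
  moreover have "rec_nat 0 (\<lambda>k r. r + a) b = a * b" for a b :: nat by (induction b) auto
  ultimately show ?thesis by (simp only:)
qed

lemma computable_diff [computable_intros]:
  assumes "computable f" "computable g" shows "computable (\<lambda>x. f x - g x)"
proof -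
  \<comment> \<open>The inner recursion is the predecessor function; iterating it gives truncated
    subtraction.\<close>
  have "computable (\<lambda>x. rec_nat (f x) (\<lambda>k r. rec_nat 0 (\<lambda>j _. j) r) (g x))"
    by (intro computable_rec_nat computable_intros assms)
  moreover have "rec_nat 0 (\<lambda>j _. j) r = r - 1" for r by (cases r) auto
  moreover have "rec_nat a (\<lambda>k r. r - 1) b = a - b" for a b by (induction b) auto
  ultimately show ?thesis by (simp only:)
qed

lemma computable_if [computable_intros]:
  assumes "computable c" "computable d" "computable f" "computable g"
  shows "computable (\<lambda>x. if c x = d x then f x else g x)"
proof -
  \<comment> \<open>The truncated differences in both directions add up to \<open>0\<close> exactly
    when \<open>c x = d x\<close>.\<close>
  have "computable (\<lambda>x. case (c x - d x) + (d x - c x) of 0 \<Rightarrow> f x | Suc k \<Rightarrow> g x)"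
    using assms by (intro computable_case_nat computable_intros computable_comp[OF assms(4)])
  moreover have "(case (c x - d x) + (d x - c x) of 0 \<Rightarrow> f x | Suc k \<Rightarrow> g x)
    = (if c x = d x then f x else g x)" for x
    by (auto split: nat.split)
  ultimately show ?thesis by (simp only:)
qed

lemma computable_funpow:
  assumes "computable f" "computable g" "computable m"
  shows "computable (\<lambda>x. (f ^^ m x) (g x))"
proof -
  have "computable (\<lambda>x. rec_nat (g x) (\<lambda>k r. f r) (m x))"
    using assms by (intro computable_rec_nat computable_intros computable_comp[OF assms(1)])
  moreover have "rec_nat a (\<lambda>k r. f r) k = (f ^^ k) a" for a k by (induction k) auto
  ultimately show ?thesis by (simp only:)
qed

text \<open>A number \<open>z\<close> is read as the infinite sequence \<open>entry 0 z, entry 1 z, \<dots>\<close>.\<close>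

definition entry :: "nat \<Rightarrow> nat \<Rightarrow> nat" where
  "entry i z = pfst (((\<lambda>x. psnd x) ^^ i) z)"

lemma computable_entry [computable_intros]:
  "computable f \<Longrightarrow> computable g \<Longrightarrow> computable (\<lambda>x. entry (f x) (g x))"
  unfolding entry_def by (intro computable_pfst computable_funpow computable_psnd computable_id)

lemma entry_simps [simp]:
  "entry 0 (prod_encode (a, b)) = a" "entry (Suc i) (prod_encode (a, b)) = entry i b"
  "0 < j \<Longrightarrow> entry j (prod_encode (a, b)) = entry (j - 1) b"
proof -
  show *: "entry (Suc i) (prod_encode (a, b)) = entry i b" for i
    by (simp add: entry_def funpow_swap1[of _ i] del: funpow.simps(2) add: funpow_Suc_right)
  then show "0 < j \<Longrightarrow> entry j (prod_encode (a, b)) = entry (j - 1) b"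
    by (metis Suc_diff_1)
qed (simp add: entry_def)

lemma ex_entry: "\<exists>z. \<forall>i<n. entry i z = f i"
proof (induction n arbitrary: f)
  case (Suc n)
  obtain z where "\<forall>i<n. entry i z = f (Suc i)" using Suc[of "\<lambda>i. f (Suc i)"] by blast
  then have "entry i (prod_encode (f 0, z)) = f i" if "i < Suc n" for i
    using that by (cases i) auto
  then show ?case by blast
qed simp

text \<open>An existential quantifier over a total computable matrix, with the value
  \<open>0\<close> for truth. Unions then become products, and intersections become sums over paired
  witnesses.\<close>

definition semidec :: "nat set \<Rightarrow> bool" where
  "semidec A \<longleftrightarrow> (\<exists>g. computable g \<and> A = {x. \<exists>z. g (prod_encode (x, z)) = 0})"

lemma semidecI:
  assumes "computable (\<lambda>x. g (pfst x) (psnd x))" "\<And>x. x \<in> A \<longleftrightarrow> (\<exists>z. g x z = 0)"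
  shows "semidec A"
  unfolding semidec_def using assms by (intro exI conjI) auto

lemma semidecE:
  assumes "semidec A"
  obtains g where "\<And>f k. computable f \<Longrightarrow> computable k \<Longrightarrow> computable (\<lambda>x. g (f x) (k x))"
    "\<And>x. x \<in> A \<longleftrightarrow> (\<exists>z. g x z = 0)"
proof -
  obtain g where g: "computable g" "A = {x. \<exists>z. g (prod_encode (x, z)) = 0}"
    using assms unfolding semidec_def by blast
  have "computable (\<lambda>x. g (prod_encode (f x, k x)))" if "computable f" "computable k" for f k
    using that by (intro computable_comp[OF g(1)] computable_intros)
  with g(2) show thesis by (intro that[of "\<lambda>x z. g (prod_encode (x, z))"]) auto
qed

text \<open>The matrix is total, so the search by \<open>Mu\<close> can diverge only by never
  meeting a zero.\<close>

lemma semidec_domain: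
  assumes "semidec A" obtains p where "\<And>x. run p x \<noteq> None \<longleftrightarrow> x \<in> A"
proof -
  obtain g q where "A = {x. \<exists>z. g (prod_encode (x, z)) = 0}" "\<forall>x. run q x = Some (g x)"
    using assms unfolding semidec_def computable_def by blast
  then show thesis by (intro that[of "Mu q"]) simp
qed

lemma semidec_empty: "semidec {}"
  by (rule semidecI[of "\<lambda>x z. 1"]) (auto intro: computable_intros)

lemma semidec_UNIV: "semidec UNIV"
  by (rule semidecI[of "\<lambda>x z. 0"]) (auto intro: computable_intros)

lemma semidec_vimage:
  assumes "semidec A" "computable f" shows "semidec {x. f x \<in> A}"
proof -
  obtain g where g: "\<And>f k. computable f \<Longrightarrow> computable k \<Longrightarrow> computable (\<lambda>x. g (f x) (k x))"
    "\<And>x. x \<in> A \<longleftrightarrow> (\<exists>z. g x z = 0)" by (rule semidecE[OF assms(1)]) (rule that)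
  show ?thesis
    by (rule semidecI[of "\<lambda>x z. g (f x) z"])
       (auto simp: g(2) intro!: g(1) computable_comp[OF assms(2)] computable_intros)
qed

lemma semidec_Un:
  assumes "semidec A" "semidec B" shows "semidec (A \<union> B)"
proof -
  obtain f where f: "\<And>a k. computable a \<Longrightarrow> computable k \<Longrightarrow> computable (\<lambda>x. f (a x) (k x))"
    "\<And>x. x \<in> A \<longleftrightarrow> (\<exists>z. f x z = 0)" by (rule semidecE[OF assms(1)]) (rule that)
  obtain g where g: "\<And>f k. computable f \<Longrightarrow> computable k \<Longrightarrow> computable (\<lambda>x. g (f x) (k x))"
    "\<And>x. x \<in> B \<longleftrightarrow> (\<exists>z. g x z = 0)" by (rule semidecE[OF assms(2)]) (rule that)
  show ?thesis
    by (rule semidecI[of "\<lambda>x z. f x z * g x z"])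
       (auto simp: f(2) g(2) intro!: f(1) g(1) computable_intros)
qed

lemma semidec_Int:
  assumes "semidec A" "semidec B" shows "semidec (A \<inter> B)"
proof -
  obtain f where f: "\<And>a k. computable a \<Longrightarrow> computable k \<Longrightarrow> computable (\<lambda>x. f (a x) (k x))"
    "\<And>x. x \<in> A \<longleftrightarrow> (\<exists>z. f x z = 0)" by (rule semidecE[OF assms(1)]) (rule that)
  obtain g where g: "\<And>f k. computable f \<Longrightarrow> computable k \<Longrightarrow> computable (\<lambda>x. g (f x) (k x))"
    "\<And>x. x \<in> B \<longleftrightarrow> (\<exists>z. g x z = 0)" by (rule semidecE[OF assms(2)]) (rule that)
  have "x \<in> A \<inter> B \<longleftrightarrow> (\<exists>z. f x (pfst z) + g x (psnd z) = 0)" for x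
    unfolding Int_iff f(2) g(2) by (metis add_is_0 fst_conv snd_conv prod_encode_inverse)
  then show ?thesis
    by (intro semidecI[of "\<lambda>x z. f x (pfst z) + g x (psnd z)"])
       (auto intro!: f(1) g(1) computable_intros)
qed

lemma semidec_Ball:
  assumes "finite I" "\<And>i. i \<in> I \<Longrightarrow> semidec {x. P i x}" shows "semidec {x. \<forall>i\<in>I. P i x}"
  using assms
proof (induction I rule: finite_induct)
  case (insert i I)
  have "{x. \<forall>j\<in>insert i I. P j x} = {x. P i x} \<inter> {x. \<forall>j\<in>I. P j x}" by auto
  then show ?case using insert by (simp add: semidec_Int)
qed (simp add: semidec_UNIV)

lemma semidec_ex:
  assumes "semidec A" shows "semidec {x. \<exists>y. prod_encode (x, y) \<in> A}"
proof -
  obtain g where g: "\<And>f k. computable f \<Longrightarrow> computable k \<Longrightarrow> computable (\<lambda>x. g (f x) (k x))"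
    "\<And>x. x \<in> A \<longleftrightarrow> (\<exists>z. g x z = 0)" by (rule semidecE[OF assms(1)]) (rule that)
  have "(\<exists>y. prod_encode (x, y) \<in> A) \<longleftrightarrow> (\<exists>z. g (prod_encode (x, pfst z)) (psnd z) = 0)" for x
    unfolding g(2) by (metis fst_conv snd_conv prod_encode_inverse)
  then show ?thesis
    by (intro semidecI[of "\<lambda>x z. g (prod_encode (x, pfst z)) (psnd z)"])
       (auto intro!: g(1) computable_intros)
qed

lemma semidec_range:
  assumes "computable f" shows "semidec (range f)"
proof (rule semidecI)
  have "computable (\<lambda>x. f (psnd x))"
    by (intro computable_comp[OF assms] computable_psnd computable_id)
  then show "computable (\<lambda>x. (pfst x - f (psnd x)) + (f (psnd x) - pfst x))"
    by (intro computable_add computable_diff computable_pfst computable_id)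
qed auto

lemma semidec_singleton: "semidec {a}"
  using semidec_range[OF computable_const[of a]] by (simp add: image_constant_conv)

section \<open>Derivability from finitely many computable rules\<close>

text \<open>The number \<open>0\<close> is a trivially true fact, used to fill the premises of axioms.\<close>

type_synonym rule = "(nat \<Rightarrow> nat) \<times> (nat \<Rightarrow> nat) \<times> (nat \<Rightarrow> nat)"

inductive_set derivable :: "rule list \<Rightarrow> nat set" for rs where
  trivial: "0 \<in> derivable rs"
| step: "(c, p, q) \<in> set rs \<Longrightarrow> p w \<in> derivable rs \<Longrightarrow> q w \<in> derivable rs \<Longrightarrow> c w \<in> derivable rs"

definition computable_rule :: "rule \<Rightarrow> bool" where
  "computable_rule r \<longleftrightarrow> computable (fst r) \<and> computable (fst (snd r)) \<and> computable (snd (snd r))"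

text \<open>An index out of range or a premise that does not match yields \<open>0\<close>, which is
  always derivable. Thus the function is total and still takes derivable premises to derivable
  conclusions only.\<close>

primrec apply_rule :: "rule list \<Rightarrow> nat \<Rightarrow> nat \<Rightarrow> nat \<Rightarrow> nat \<Rightarrow> nat" where
  "apply_rule [] i w a b = 0"
| "apply_rule (r # rs) i w a b = (if i = 0
     then if fst (snd r) w = a then if snd (snd r) w = b then fst r w else 0 else 0
     else apply_rule rs (i - 1) w a b)"

lemma apply_rule_derivable:
  assumes "a \<in> derivable rs" "b \<in> derivable rs" "set rs' \<subseteq> set rs"
  shows "apply_rule rs' i w a b \<in> derivable rs"
  using assms by (induction rs' arbitrary: i) (auto intro: derivable.intros)

lemma apply_rule_nth:
  "i < length rs \<Longrightarrow> rs ! i = (c, p, q) \<Longrightarrow> apply_rule rs i w (p w) (q w) = c w"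
  by (induction rs arbitrary: i) (auto simp: nth_Cons' split: if_splits)

lemma computable_apply_rule:
  assumes "\<forall>r\<in>set rs. computable_rule r"
    and "computable i" "computable w" "computable a" "computable b"
  shows "computable (\<lambda>x. apply_rule rs (i x) (w x) (a x) (b x))"
  using assms
proof (induction rs arbitrary: i)
  case (Cons r rs)
  have *: "computable (\<lambda>x. apply_rule rs (i x - 1) (w x) (a x) (b x))"
    using Cons.prems by (intro Cons.IH computable_intros) auto
  have "computable (\<lambda>x. fst r (w x))" "computable (\<lambda>x. fst (snd r) (w x))"
    "computable (\<lambda>x. snd (snd r) (w x))"
    using Cons.prems by (auto simp: computable_rule_def intro: computable_comp)
  with * show ?case using Cons.prems by (simp only: apply_rule.simps) (intro computable_intros)
qed (simp add: computable_const)

text \<open>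
  A derivation is coded as \<open>Suc \<langle>\<langle>i, w\<rangle>, \<langle>y, z\<rangle>\<rangle>\<close>, where \<open>i\<close> is the index of the last rule,
  \<open>w\<close> its parameter, and \<open>y\<close>, \<open>z\<close> are derivations of the premises. \<open>history rs d\<close> lists the
  conclusions of \<open>d, d - 1, \<dots>, 0\<close>, so that \<open>derivable rs\<close> is the range of a computable function.
\<close>

definition history :: "rule list \<Rightarrow> nat \<Rightarrow> nat" where
  "history rs = rec_nat 0 (\<lambda>k r. prod_encode (apply_rule rs (pfst (pfst k)) (psnd (pfst k))
     (entry (k - pfst (psnd k)) r) (entry (k - psnd (psnd k)) r), r))"

definition conclusion :: "rule list \<Rightarrow> nat \<Rightarrow> nat" where
  "conclusion rs d = entry 0 (history rs d)"

lemma conclusion_0: "conclusion rs 0 = 0"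
proof -
  have "prod_decode 0 = (0, 0)"
    using prod_encode_inverse[of "(0, 0)"] by (simp add: prod_encode_def)
  then show ?thesis by (simp add: conclusion_def history_def entry_def)
qed

lemma entry_history: "j \<le> k \<Longrightarrow> entry (k - j) (history rs k) = conclusion rs j"
proof (induction k)
  case (Suc k)
  have h: "history rs (Suc k) = prod_encode (conclusion rs (Suc k), history rs k)"
    by (simp add: conclusion_def history_def)
  show ?case
  proof (cases "j = Suc k")
    case False
    then show ?thesis using Suc by (simp add: h Suc_diff_le)
  qed (simp add: conclusion_def)
qed (simp add: conclusion_def)

lemma conclusion_Suc:
  "conclusion rs (Suc (prod_encode (prod_encode (i, w), prod_encode (y, z))))
     = apply_rule rs i w (conclusion rs y) (conclusion rs z)"
proof -
  define k where "k = prod_encode (prod_encode (i, w), prod_encode (y, z))"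
  \<comment> \<open>A pair is at least as large as its components, so the premises have codes up to
    \<open>k\<close> and their conclusions are already listed in
    \<open>history rs k\<close>.\<close>
  have "y \<le> k" "z \<le> k"
    unfolding k_def using le_prod_encode_2 le_prod_encode_1 order.trans by blast+
  then show ?thesis
    unfolding k_def[symmetric] conclusion_def[of _ "Suc k"]
    by (simp add: history_def flip: entry_history) (simp add: k_def history_def)
qed

lemma range_conclusion: "range (conclusion rs) = derivable rs"
proof
  have "conclusion rs d \<in> derivable rs" for d
  proof (induction d rule: less_induct)
    case (less d)
    show ?case
    proof (cases d)
      case (Suc k)
      obtain i w y z where k: "k = prod_encode (prod_encode (i, w), prod_encode (y, z))"
        by (metis prod.exhaust prod_decode_inverse)
      have "y \<le> k" "z \<le> k"
        unfolding k using le_prod_encode_2 le_prod_encode_1 order.trans by blast+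
      then show ?thesis using less Suc unfolding Suc
        by (simp add: k conclusion_Suc apply_rule_derivable)
    qed (simp add: conclusion_0 derivable.trivial)
  qed
  then show "range (conclusion rs) \<subseteq> derivable rs" by blast
  have "x \<in> range (conclusion rs)" if "x \<in> derivable rs" for x
    using that
  proof induction
    case trivial
    then show ?case by (metis conclusion_0 rangeI)
  next
    case (step c p q w)
    then obtain i y z where "i < length rs" "rs ! i = (c, p, q)"
      "p w = conclusion rs y" "q w = conclusion rs z"
      by (auto simp: in_set_conv_nth)
    then have "c w = conclusion rs (Suc (prod_encode (prod_encode (i, w), prod_encode (y, z))))"
      using apply_rule_nth[of i rs c p q w] by (simp add: conclusion_Suc)
    then show ?case by blast
  qed
  then show "derivable rs \<subseteq> range (conclusion rs)" by blast
qed

lemma semidec_derivable: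
  assumes "\<forall>r\<in>set rs. computable_rule r" shows "semidec (derivable rs)"
proof -
  have "computable (history rs)" unfolding history_def
    by (intro computable_rec_nat[where a = "\<lambda>_. 0" and m = "\<lambda>x. x"]
          computable_intros computable_apply_rule assms)
  then have "computable (conclusion rs)"
    unfolding conclusion_def by (intro computable_entry computable_const)
  then show ?thesis using semidec_range by (metis range_conclusion)
qed

section \<open>Indices of semidecidable sets and the recursion theorem\<close>

abbreviation decode_prog :: "nat \<Rightarrow> prog" where "decode_prog \<equiv> inv_into UNIV prog_code"

lemma decode_prog_code [simp]: "decode_prog (prog_code p) = p"
  by (simp add: inj_prog_code)

lemma prog_code_decode [simp]: "prog_code (decode_prog e) = e"
  by (meson bij_prog_code bij_inv_eq_iff)

lemma W_prog_code: "W (prog_code p) = {x. run p x \<noteq> None}"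
  by (simp add: W_def phi_def)

lemma semidec_W: assumes "semidec A" obtains e where "W e = A"
proof -
  obtain p where "\<And>x. run p x \<noteq> None \<longleftrightarrow> x \<in> A" by (rule semidec_domain[OF assms]) (rule that)
  then have "W (prog_code p) = A" unfolding W_prog_code by blast
  then show thesis by (rule that)
qed

primrec const_prog :: "nat \<Rightarrow> prog" where
  "const_prog 0 = Zero"
| "const_prog (Suc c) = Comp Succ (const_prog c)"

lemma run_const_prog [simp]: "run (const_prog c) x = Some c"
  by (induction c) auto

text \<open>Kleene's diagonal argument: \<open>d u\<close> is an index of the program that runs
  program \<open>u\<close> on the pair of \<open>u\<close> and the input. If \<open>p\<close>
  accepts a pair of \<open>u\<close> and \<open>x\<close> exactly when the pair of
  \<open>d u\<close> and \<open>x\<close> is in \<open>B\<close>, then \<open>d\<close> applied to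
  the code of \<open>p\<close> is the required index.\<close>

lemma recursion_theorem:
  assumes "semidec B" obtains e where "W e = {x. prod_encode (e, x) \<in> B}"
proof -
  define d where "d u = prog_code (Comp (decode_prog u) (Pair (const_prog u) (Pair Fst Snd)))" for u
  \<comment> \<open>Computability of \<open>d\<close> rests on computing the code of
    \<open>const_prog u\<close> from \<open>u\<close>; the \<open>1\<close> is the code of
    \<open>Succ\<close>.\<close>
  have "prog_code (const_prog u) = rec_nat 0 (\<lambda>_ r. 5 + 4 * prod_encode (1, r)) u" for u
    by (induction u) auto
  then have "computable (\<lambda>u. prog_code (const_prog u))"
    by (simp only:) (intro computable_rec_nat computable_intros)
  then have d: "computable d"
    unfolding d_def prog_code.simps prog_code_decode by (intro computable_intros)
  have "semidec {y. prod_encode (d (pfst y), psnd y) \<in> B}"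
    using assms by (rule semidec_vimage) (intro computable_intros computable_comp[OF d])
  then obtain p where p: "\<And>y. run p y \<noteq> None \<longleftrightarrow> prod_encode (d (pfst y), psnd y) \<in> B"
    by (rule semidec_domain) blast
  have "run (decode_prog (d (prog_code p))) x = run p (prod_encode (prog_code p, x))" for x
    unfolding d_def decode_prog_code by simp
  then have "W (d (prog_code p)) = {x. run p (prod_encode (prog_code p, x)) \<noteq> None}"
    unfolding W_def phi_def by simp
  then have "W (d (prog_code p)) = {x. prod_encode (d (prog_code p), x) \<in> B}"
    unfolding p by simp
  then show thesis by (rule that)
qed

section \<open>Homomorphisms out of a finitely presented monoid are semidecidable\<close>

text \<open>Successor values below \<open>n\<close> say at once that the earlier trials halt and
  that they fail. In this form search can be captured by derivation rules.\<close>

lemma run_Mu_SomeI: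
  assumes "run p (prod_encode (x, n)) = Some 0"
    and "\<forall>k<n. \<exists>v. run p (prod_encode (x, k)) = Some (Suc v)"
  shows "run (Mu p) x = Some n"
proof -
  have "(LEAST n. run p (prod_encode (x, n)) = Some 0) = n"
    using assms by (intro Least_equality) (force simp: linorder_not_less[symmetric])+
  moreover have "\<exists>n. run p (prod_encode (x, n)) = Some 0 \<and> (\<forall>k<n. run p (prod_encode (x, k)) \<noteq> None)"
    using assms by force
  ultimately show ?thesis by simp
qed

lemma run_Mu_SomeD:
  assumes "run (Mu p) x = Some n"
  shows "run p (prod_encode (x, n)) = Some 0"
    and "k < n \<Longrightarrow> \<exists>v. run p (prod_encode (x, k)) = Some (Suc v)"
proof -
  obtain m where m: "run p (prod_encode (x, m)) = Some 0"
    "\<forall>k<m. run p (prod_encode (x, k)) \<noteq> None"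
    and n: "n = (LEAST n. run p (prod_encode (x, n)) = Some 0)"
    using assms by (auto split: if_splits)
  show "run p (prod_encode (x, n)) = Some 0" unfolding n using m(1) by (rule LeastI)
  have "n \<le> m" unfolding n using m(1) by (rule Least_le)
  moreover have "k < n \<Longrightarrow> run p (prod_encode (x, k)) \<noteq> Some 0" unfolding n by (rule not_less_Least)
  ultimately show "k < n \<Longrightarrow> \<exists>v. run p (prod_encode (x, k)) = Some (Suc v)"
    using m(2) by (metis less_le_trans not0_implies_Suc option.exhaust)
qed

abbreviation cong :: "nat \<Rightarrow> nat \<Rightarrow> (trm \<times> trm) set" where
  "cong n a \<equiv> cm_congruence n (coded_pairs n (W a))"

primrec subst :: "(nat \<Rightarrow> trm) \<Rightarrow> trm \<Rightarrow> trm" where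
  "subst f (Var i) = f i"
| "subst f Unit = Unit"
| "subst f (Times s t) = Times (subst f s) (subst f t)"

lemma subst_terms:
  "t \<in> terms n \<Longrightarrow> (\<And>i. i < n \<Longrightarrow> f i \<in> terms n) \<Longrightarrow> subst f t \<in> terms n"
  by (induction t) auto

definition decode_term :: "nat \<Rightarrow> nat \<Rightarrow> trm" where
  "decode_term n = inv_into (terms n) (term_code n)"

lemma decode_term_in [simp]: "decode_term n k \<in> terms n"
  unfolding decode_term_def
  by (rule inv_into_into) (simp add: bij_betw_imp_surj_on[OF bij_betw_term_code])

lemma term_code_decode [simp]: "term_code n (decode_term n k) = k"
  unfolding decode_term_def by (rule bij_betw_inv_into_right[OF bij_betw_term_code]) simp

lemma decode_term_code [simp]: "t \<in> terms n \<Longrightarrow> decode_term n (term_code n t) = t"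
  unfolding decode_term_def by (rule bij_betw_inv_into_left[OF bij_betw_term_code])

definition times_code :: "nat \<Rightarrow> nat \<Rightarrow> nat \<Rightarrow> nat" where
  "times_code n s t = Suc n + prod_encode (s, t)"

lemma term_code_Times: "term_code n (Times s t) = times_code n (term_code n s) (term_code n t)"
  by (simp add: times_code_def)

lemma decode_term_simps [simp]:
  "decode_term n 0 = Unit" "i < n \<Longrightarrow> decode_term n (Suc i) = Var i"
  "decode_term n (times_code n s t) = Times (decode_term n s) (decode_term n t)"
  using decode_term_code[of Unit n] decode_term_code[of "Var i" n]
    decode_term_code[of "Times (decode_term n s) (decode_term n t)" n]
  by (simp_all add: times_code_def)

definition prog_node :: "nat \<Rightarrow> nat \<Rightarrow> nat \<Rightarrow> nat" where
  "prog_node c a b = c + 4 * prod_encode (a, b)"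

definition Mu_code :: "nat \<Rightarrow> nat" where "Mu_code a = 7 + 4 * a"

lemma prog_code_node:
  "prog_code (Pair p q) = prog_node 4 (prog_code p) (prog_code q)"
  "prog_code (Comp p q) = prog_node 5 (prog_code p) (prog_code q)"
  "prog_code (Prec p q) = prog_node 6 (prog_code p) (prog_code q)"
  "prog_code (Mu p) = Mu_code (prog_code p)"
  by (simp_all add: prog_node_def Mu_code_def)

lemma decode_prog_node [simp]:
  "decode_prog 0 = Zero" "decode_prog (Suc 0) = Succ" "decode_prog 2 = Fst" "decode_prog 3 = Snd"
  "decode_prog (prog_node 4 a b) = Pair (decode_prog a) (decode_prog b)"
  "decode_prog (prog_node 5 a b) = Comp (decode_prog a) (decode_prog b)"
  "decode_prog (prog_node 6 a b) = Prec (decode_prog a) (decode_prog b)"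
  "decode_prog (Mu_code a) = Mu (decode_prog a)"
  using decode_prog_code[of Zero] decode_prog_code[of Succ] decode_prog_code[of Fst]
    decode_prog_code[of Snd] decode_prog_code[of "Pair (decode_prog a) (decode_prog b)"]
    decode_prog_code[of "Comp (decode_prog a) (decode_prog b)"]
    decode_prog_code[of "Prec (decode_prog a) (decode_prog b)"]
    decode_prog_code[of "Mu (decode_prog a)"]
  by (simp_all only: prog_code_node prog_code_decode) simp_all

text \<open>The tags \<open>1\<close> to \<open>4\<close> keep the four kinds of facts apart from
  each other and from the trivial fact \<open>0\<close>.\<close>

definition run_fact :: "nat \<Rightarrow> nat \<Rightarrow> nat \<Rightarrow> nat" where
  "run_fact e x y = prod_encode (1, prod_encode (e, prod_encode (x, y)))"

definition below_fact :: "nat \<Rightarrow> nat \<Rightarrow> nat \<Rightarrow> nat" where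
  "below_fact e x k = prod_encode (2, prod_encode (e, prod_encode (x, k)))"

definition eq_fact :: "nat \<Rightarrow> nat \<Rightarrow> nat \<Rightarrow> nat" where
  "eq_fact a s t = prod_encode (3, prod_encode (a, prod_encode (s, t)))"

definition hom_fact :: "nat \<Rightarrow> nat \<Rightarrow> nat \<Rightarrow> nat \<Rightarrow> nat" where
  "hom_fact a z t u = prod_encode (4, prod_encode (a, prod_encode (z, prod_encode (t, u))))"

text \<open>
  The fact \<open>below_fact e x k\<close> lets unbounded search be described by rules with two premises;
  \<open>hom_fact a z t u\<close> means that \<open>t\<close> evaluates to \<open>u\<close> in \<open>CM_alg n a\<close> under the
  assignment coded by \<open>z\<close>.
\<close>

definition true_facts :: "nat \<Rightarrow> nat set" where
  "true_facts n = {0}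
    \<union> {run_fact e x y | e x y. run (decode_prog e) x = Some y}
    \<union> {below_fact e x k | e x k. \<forall>j<k. \<exists>v. run (decode_prog e) (prod_encode (x, j)) = Some (Suc v)}
    \<union> {eq_fact a s t | a s t. (decode_term n s, decode_term n t) \<in> cong n a}
    \<union> {hom_fact a z t u | a z t u.
        (subst (\<lambda>i. decode_term n (entry i z)) (decode_term n t), decode_term n u) \<in> cong n a}"

lemma prod_encode_Suc_neq_0: "c > 0 \<Longrightarrow> prod_encode (c, x) \<noteq> 0"
  using le_prod_encode_1[of c x] by linarith

lemma true_facts_iff [simp]:
  "0 \<in> true_facts n"
  "run_fact e x y \<in> true_facts n \<longleftrightarrow> run (decode_prog e) x = Some y"
  "below_fact e x k \<in> true_facts n
     \<longleftrightarrow> (\<forall>j<k. \<exists>v. run (decode_prog e) (prod_encode (x, j)) = Some (Suc v))"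
  "eq_fact a s t \<in> true_facts n \<longleftrightarrow> (decode_term n s, decode_term n t) \<in> cong n a"
  "hom_fact a z t u \<in> true_facts n \<longleftrightarrow>
     (subst (\<lambda>i. decode_term n (entry i z)) (decode_term n t), decode_term n u) \<in> cong n a"
  by (auto simp: true_facts_def run_fact_def below_fact_def eq_fact_def hom_fact_def
      prod_encode_eq prod_encode_Suc_neq_0)

text \<open>Rules 0 to 10 evaluate programs, rules 11 to 18 generate the congruence, and rules 19
  onwards evaluate terms under an assignment. The parameter \<open>w\<close> carries all the
  variables of a rule as its entries. The order matters, since each rule is later cited by its
  position.\<close>

definition fact_rules :: "nat \<Rightarrow> rule list" where
  "fact_rules n =
    [(\<lambda>w. run_fact 0 w 0, \<lambda>w. 0, \<lambda>w. 0),
     (\<lambda>w. run_fact 1 w (Suc w), \<lambda>w. 0, \<lambda>w. 0),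
     (\<lambda>w. run_fact 2 w (pfst w), \<lambda>w. 0, \<lambda>w. 0),
     (\<lambda>w. run_fact 3 w (psnd w), \<lambda>w. 0, \<lambda>w. 0),
     (\<lambda>w. run_fact (prog_node 4 (entry 0 w) (entry 1 w)) (entry 2 w) (prod_encode (entry 3 w, entry 4 w)),
      \<lambda>w. run_fact (entry 0 w) (entry 2 w) (entry 3 w),
      \<lambda>w. run_fact (entry 1 w) (entry 2 w) (entry 4 w)),
     (\<lambda>w. run_fact (prog_node 5 (entry 0 w) (entry 1 w)) (entry 2 w) (entry 4 w),
      \<lambda>w. run_fact (entry 1 w) (entry 2 w) (entry 3 w),
      \<lambda>w. run_fact (entry 0 w) (entry 3 w) (entry 4 w)),
     (\<lambda>w. run_fact (prog_node 6 (entry 0 w) (entry 1 w)) (prod_encode (entry 2 w, 0)) (entry 3 w),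
      \<lambda>w. run_fact (entry 0 w) (entry 2 w) (entry 3 w), \<lambda>w. 0),
     (\<lambda>w. run_fact (prog_node 6 (entry 0 w) (entry 1 w)) (prod_encode (entry 2 w, Suc (entry 3 w))) (entry 5 w),
      \<lambda>w. run_fact (prog_node 6 (entry 0 w) (entry 1 w)) (prod_encode (entry 2 w, entry 3 w)) (entry 4 w),
      \<lambda>w. run_fact (entry 1 w) (prod_encode (entry 2 w, prod_encode (entry 3 w, entry 4 w))) (entry 5 w)),
     (\<lambda>w. below_fact (entry 0 w) (entry 1 w) 0, \<lambda>w. 0, \<lambda>w. 0),
     (\<lambda>w. below_fact (entry 0 w) (entry 1 w) (Suc (entry 2 w)),
      \<lambda>w. below_fact (entry 0 w) (entry 1 w) (entry 2 w),
      \<lambda>w. run_fact (entry 0 w) (prod_encode (entry 1 w, entry 2 w)) (Suc (entry 3 w))),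
     (\<lambda>w. run_fact (Mu_code (entry 0 w)) (entry 1 w) (entry 2 w),
      \<lambda>w. below_fact (entry 0 w) (entry 1 w) (entry 2 w),
      \<lambda>w. run_fact (entry 0 w) (prod_encode (entry 1 w, entry 2 w)) 0),
     (\<lambda>w. eq_fact (entry 0 w) (entry 1 w) (entry 2 w),
      \<lambda>w. run_fact (entry 0 w) (prod_encode (entry 1 w, entry 2 w)) (entry 3 w), \<lambda>w. 0),
     (\<lambda>w. eq_fact (entry 0 w) (times_code n (times_code n (entry 1 w) (entry 2 w)) (entry 3 w))
        (times_code n (entry 1 w) (times_code n (entry 2 w) (entry 3 w))), \<lambda>w. 0, \<lambda>w. 0),
     (\<lambda>w. eq_fact (entry 0 w) (times_code n (entry 1 w) (entry 2 w))
        (times_code n (entry 2 w) (entry 1 w)), \<lambda>w. 0, \<lambda>w. 0),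
     (\<lambda>w. eq_fact (entry 0 w) (times_code n 0 (entry 1 w)) (entry 1 w), \<lambda>w. 0, \<lambda>w. 0),
     (\<lambda>w. eq_fact (entry 0 w) (entry 1 w) (entry 1 w), \<lambda>w. 0, \<lambda>w. 0),
     (\<lambda>w. eq_fact (entry 0 w) (entry 2 w) (entry 1 w),
      \<lambda>w. eq_fact (entry 0 w) (entry 1 w) (entry 2 w), \<lambda>w. 0),
     (\<lambda>w. eq_fact (entry 0 w) (entry 1 w) (entry 3 w),
      \<lambda>w. eq_fact (entry 0 w) (entry 1 w) (entry 2 w),
      \<lambda>w. eq_fact (entry 0 w) (entry 2 w) (entry 3 w)),
     (\<lambda>w. eq_fact (entry 0 w) (times_code n (entry 1 w) (entry 3 w)) (times_code n (entry 2 w) (entry 4 w)),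
      \<lambda>w. eq_fact (entry 0 w) (entry 1 w) (entry 2 w),
      \<lambda>w. eq_fact (entry 0 w) (entry 3 w) (entry 4 w)),
     (\<lambda>w. hom_fact (entry 0 w) (entry 1 w) 0 0, \<lambda>w. 0, \<lambda>w. 0),
     (\<lambda>w. hom_fact (entry 0 w) (entry 1 w) (times_code n (entry 2 w) (entry 3 w)) (times_code n (entry 4 w) (entry 5 w)),
      \<lambda>w. hom_fact (entry 0 w) (entry 1 w) (entry 2 w) (entry 4 w),
      \<lambda>w. hom_fact (entry 0 w) (entry 1 w) (entry 3 w) (entry 5 w)),
     (\<lambda>w. hom_fact (entry 0 w) (entry 1 w) (entry 2 w) (entry 4 w),
      \<lambda>w. hom_fact (entry 0 w) (entry 1 w) (entry 2 w) (entry 3 w),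
      \<lambda>w. eq_fact (entry 0 w) (entry 3 w) (entry 4 w))]
    @ map (\<lambda>i. (\<lambda>w. hom_fact (entry 0 w) (entry 1 w) (Suc i) (entry i (entry 1 w)), \<lambda>w. 0, \<lambda>w. 0)) [0..<n]"

lemma computable_fact_rules: "\<forall>r\<in>set (fact_rules n). computable_rule r"
  unfolding fact_rules_def run_fact_def below_fact_def eq_fact_def hom_fact_def
    prog_node_def Mu_code_def times_code_def
  by (auto simp: computable_rule_def intro!: computable_intros)

lemma derivable_sound: "f \<in> derivable (fact_rules n) \<Longrightarrow> f \<in> true_facts n"
proof (induction rule: derivable.induct)
  case (step c p q w)
  have base: "(decode_term n s, decode_term n t) \<in> cong n a"
    if "run (decode_prog a) (prod_encode (s, t)) = Some y" for s t a y
    using that by (intro cm_congruence.base) (auto simp: coded_pairs_def W_def phi_def)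
  have "\<forall>r\<in>set (fact_rules n). \<forall>w. fst (snd r) w \<in> true_facts n \<longrightarrow> snd (snd r) w \<in> true_facts n
      \<longrightarrow> fst r w \<in> true_facts n"
    unfolding fact_rules_def set_append ball_Un list.set ball_simps fst_conv snd_conv true_facts_iff
  proof (intro conjI allI impI)
    fix w assume "\<forall>j<entry 2 w. \<exists>v. run (decode_prog (entry 0 w)) (prod_encode (entry 1 w, j)) = Some (Suc v)"
      "run (decode_prog (entry 0 w)) (prod_encode (entry 1 w, entry 2 w)) = Some 0"
    then show "run (decode_prog (Mu_code (entry 0 w))) (entry 1 w) = Some (entry 2 w)"
      by (simp only: decode_prog_node) (rule run_Mu_SomeI)
  qed (simp_all add: less_Suc_eq cm_congruence.refl cm_congruence.assoc cm_congruence.comm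
         cm_congruence.unit cm_congruence.times cm_congruence.sym base,
       auto intro: cm_congruence.trans)
  from bspec[OF this step.hyps(1)] show ?case using step.IH by simp
qed simp

section \<open>Completeness of the rules\<close>

lemma derivable_nth:
  assumes "i < length rs" "fst (snd (rs ! i)) w \<in> derivable rs" "snd (snd (rs ! i)) w \<in> derivable rs"
  shows "fst (rs ! i) w \<in> derivable rs"
  by (rule derivable.step[of _ "fst (snd (rs ! i))" "snd (snd (rs ! i))"])
     (use assms in simp_all)

abbreviation facts :: "nat \<Rightarrow> nat set" where "facts n \<equiv> derivable (fact_rules n)"

lemma run_fact_intros:
  "run_fact 0 x 0 \<in> facts n" "run_fact 1 x (Suc x) \<in> facts n"
  "run_fact 2 x (pfst x) \<in> facts n" "run_fact 3 x (psnd x) \<in> facts n"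
  using derivable_nth[of 0 "fact_rules n" x] derivable_nth[of 1 "fact_rules n" x]
    derivable_nth[of 2 "fact_rules n" x] derivable_nth[of 3 "fact_rules n" x]
  by (simp_all add: fact_rules_def derivable.trivial)

primrec tuple :: "nat list \<Rightarrow> nat" where
  "tuple [] = 0"
| "tuple (x # xs) = prod_encode (x, tuple xs)"

lemma run_fact_Pair:
  "run_fact p x a \<in> facts n \<Longrightarrow> run_fact q x b \<in> facts n
    \<Longrightarrow> run_fact (prog_node 4 p q) x (prod_encode (a, b)) \<in> facts n"
  using derivable_nth[of 4 "fact_rules n" "tuple [p, q, x, a, b]"] by (simp add: fact_rules_def)

lemma run_fact_Comp:
  "run_fact q x y \<in> facts n \<Longrightarrow> run_fact p y z \<in> facts n
    \<Longrightarrow> run_fact (prog_node 5 p q) x z \<in> facts n"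
  using derivable_nth[of 5 "fact_rules n" "tuple [p, q, x, y, z]"] by (simp add: fact_rules_def)

lemma run_fact_Prec_0:
  "run_fact p a y \<in> facts n \<Longrightarrow> run_fact (prog_node 6 p q) (prod_encode (a, 0)) y \<in> facts n"
  using derivable_nth[of 6 "fact_rules n" "tuple [p, q, a, y]"]
  by (simp add: fact_rules_def derivable.trivial)

lemma run_fact_Prec_Suc:
  "run_fact (prog_node 6 p q) (prod_encode (a, k)) v \<in> facts n
    \<Longrightarrow> run_fact q (prod_encode (a, prod_encode (k, v))) y \<in> facts n
    \<Longrightarrow> run_fact (prog_node 6 p q) (prod_encode (a, Suc k)) y \<in> facts n"
  using derivable_nth[of 7 "fact_rules n" "tuple [p, q, a, k, v, y]"] by (simp add: fact_rules_def)

lemma below_fact_0: "below_fact p x 0 \<in> facts n"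
  using derivable_nth[of 8 "fact_rules n" "tuple [p, x]"]
  by (simp add: fact_rules_def derivable.trivial)

lemma below_fact_Suc:
  "below_fact p x k \<in> facts n \<Longrightarrow> run_fact p (prod_encode (x, k)) (Suc v) \<in> facts n
    \<Longrightarrow> below_fact p x (Suc k) \<in> facts n"
  using derivable_nth[of 9 "fact_rules n" "tuple [p, x, k, v]"] by (simp add: fact_rules_def)

lemma run_fact_Mu:
  "below_fact p x k \<in> facts n \<Longrightarrow> run_fact p (prod_encode (x, k)) 0 \<in> facts n
    \<Longrightarrow> run_fact (Mu_code p) x k \<in> facts n"
  using derivable_nth[of 10 "fact_rules n" "tuple [p, x, k]"] by (simp add: fact_rules_def)

lemma run_fact_derivable: "run p x = Some y \<Longrightarrow> run_fact (prog_code p) x y \<in> facts n"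
proof (induction p arbitrary: x y)
  case (Pair p q)
  then show ?case unfolding prog_code_node
    by (auto simp: bind_eq_Some_conv intro: run_fact_Pair)
next
  case (Comp p q)
  then show ?case unfolding prog_code_node
    by (auto simp: bind_eq_Some_conv) (blast intro: run_fact_Comp Comp.IH)
next
  case (Prec p q)
  obtain a m where x: "x = prod_encode (a, m)"
    by (metis prod.exhaust prod_decode_inverse)
  from Prec.prems show ?case unfolding prog_code_node x
  proof (induction m arbitrary: y)
    case 0
    then show ?case by (auto intro: run_fact_Prec_0 Prec.IH)
  next
    case (Suc m)
    then show ?case by (auto simp: bind_eq_Some_conv intro: run_fact_Prec_Suc Prec.IH)
  qed
next
  case (Mu p)
  \<comment> \<open>Each failed trial before the result \<open>y\<close> raises the bound by
    one.\<close>
  have "k \<le> y \<Longrightarrow> below_fact (prog_code p) x k \<in> facts n" for k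
  proof (induction k)
    case (Suc k)
    then obtain v where "run p (prod_encode (x, k)) = Some (Suc v)"
      using run_Mu_SomeD(2)[OF Mu.prems, of k] by auto
    then show ?case using Suc Mu.IH by (auto intro: below_fact_Suc)
  qed (simp add: below_fact_0)
  then show ?case unfolding prog_code_node
    by (intro run_fact_Mu Mu.IH run_Mu_SomeD(1)[OF Mu.prems]) auto
qed (use run_fact_intros in auto)

lemma eq_fact_base:
  "run_fact a (prod_encode (s, t)) y \<in> facts n \<Longrightarrow> eq_fact a s t \<in> facts n"
  using derivable_nth[of 11 "fact_rules n" "tuple [a, s, t, y]"]
  by (simp add: fact_rules_def derivable.trivial)

lemma eq_fact_laws:
  "eq_fact a (times_code n (times_code n r s) t) (times_code n r (times_code n s t)) \<in> facts n"
  "eq_fact a (times_code n s t) (times_code n t s) \<in> facts n"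
  "eq_fact a (times_code n 0 t) t \<in> facts n"
  "eq_fact a t t \<in> facts n"
  using derivable_nth[of 12 "fact_rules n" "tuple [a, r, s, t]"]
    derivable_nth[of 13 "fact_rules n" "tuple [a, s, t]"]
    derivable_nth[of 14 "fact_rules n" "tuple [a, t]"]
    derivable_nth[of 15 "fact_rules n" "tuple [a, t]"]
  by (simp_all add: fact_rules_def derivable.trivial)

lemma eq_fact_sym: "eq_fact a s t \<in> facts n \<Longrightarrow> eq_fact a t s \<in> facts n"
  using derivable_nth[of 16 "fact_rules n" "tuple [a, s, t]"]
  by (simp add: fact_rules_def derivable.trivial)

lemma eq_fact_trans:
  "eq_fact a r s \<in> facts n \<Longrightarrow> eq_fact a s t \<in> facts n \<Longrightarrow> eq_fact a r t \<in> facts n"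
  using derivable_nth[of 17 "fact_rules n" "tuple [a, r, s, t]"] by (simp add: fact_rules_def)

lemma eq_fact_times:
  "eq_fact a s s' \<in> facts n \<Longrightarrow> eq_fact a t t' \<in> facts n
    \<Longrightarrow> eq_fact a (times_code n s t) (times_code n s' t') \<in> facts n"
  using derivable_nth[of 18 "fact_rules n" "tuple [a, s, s', t, t']"] by (simp add: fact_rules_def)

lemma eq_fact_derivable:
  "(s, t) \<in> cong n a \<Longrightarrow> eq_fact a (term_code n s) (term_code n t) \<in> facts n"
proof (induction rule: cm_congruence.induct)
  case (base s t)
  then obtain y where "run (decode_prog a) (prod_encode (term_code n s, term_code n t)) = Some y"
    by (auto simp: coded_pairs_def W_def phi_def)
  from run_fact_derivable[OF this] show ?case by (auto intro: eq_fact_base)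
next
  case (sym s t) from sym.IH show ?case by (rule eq_fact_sym)
next
  case (trans r s t) from trans.IH show ?case by (rule eq_fact_trans)
next
  case (times s s' t t') then show ?case unfolding term_code_Times by (intro eq_fact_times)
next
  case (unit t) then show ?case unfolding term_code_Times using eq_fact_laws by simp
next
  case (assoc r s t) show ?case unfolding term_code_Times by (rule eq_fact_laws)
next
  case (comm s t) show ?case unfolding term_code_Times by (rule eq_fact_laws)
next
  case (refl t) show ?case by (rule eq_fact_laws)
qed

lemma hom_fact_Unit: "hom_fact a z 0 0 \<in> facts n"
  using derivable_nth[of 19 "fact_rules n" "tuple [a, z]"]
  by (simp add: fact_rules_def derivable.trivial)

lemma hom_fact_Times:
  "hom_fact a z p u \<in> facts n \<Longrightarrow> hom_fact a z q v \<in> facts n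
    \<Longrightarrow> hom_fact a z (times_code n p q) (times_code n u v) \<in> facts n"
  using derivable_nth[of 20 "fact_rules n" "tuple [a, z, p, q, u, v]"] by (simp add: fact_rules_def)

lemma hom_fact_eq:
  "hom_fact a z t u \<in> facts n \<Longrightarrow> eq_fact a u v \<in> facts n \<Longrightarrow> hom_fact a z t v \<in> facts n"
  using derivable_nth[of 21 "fact_rules n" "tuple [a, z, t, u, v]"] by (simp add: fact_rules_def)

lemma hom_fact_Var: "i < n \<Longrightarrow> hom_fact a z (Suc i) (entry i z) \<in> facts n"
  using derivable_nth[of "22 + i" "fact_rules n" "tuple [a, z]"]
  by (simp add: fact_rules_def derivable.trivial nth_append)

lemma hom_fact_subst:
  assumes "t \<in> terms n"
  shows "hom_fact a z (term_code n t) (term_code n (subst (\<lambda>i. decode_term n (entry i z)) t)) \<in> facts n"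
  using assms
proof (induction t)
  case (Var i) then show ?case using hom_fact_Var[of i n a z] by simp
next
  case Unit then show ?case using hom_fact_Unit by simp
next
  case (Times s t) then show ?case unfolding subst.simps term_code_Times by (auto intro: hom_fact_Times)
qed

text \<open>Soundness gives one direction. For the other, the term is first evaluated literally by
  \<open>hom_fact_subst\<close>, and then its value is moved along a derivable equation.\<close>

lemma hom_fact_iff:
  "hom_fact a z t u \<in> facts n \<longleftrightarrow>
     (subst (\<lambda>i. decode_term n (entry i z)) (decode_term n t), decode_term n u) \<in> cong n a"
proof
  assume "hom_fact a z t u \<in> facts n"
  from derivable_sound[OF this]
  show "(subst (\<lambda>i. decode_term n (entry i z)) (decode_term n t), decode_term n u) \<in> cong n a" by simp
next
  assume "(subst (\<lambda>i. decode_term n (entry i z)) (decode_term n t), decode_term n u) \<in> cong n a"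
  from hom_fact_eq[OF hom_fact_subst eq_fact_derivable[OF this]]
  show "hom_fact a z t u \<in> facts n" using decode_term_in term_code_decode by metis
qed

text \<open>
  \<open>covered n F a\<close> says that there is a surjective homomorphism onto \<open>CM_alg n a\<close> from the
  commutative monoid generated by \<open>X\<^sub>n\<close> with defining relations \<open>F\<close>.
\<close>

definition covered :: "nat \<Rightarrow> (trm \<times> trm) set \<Rightarrow> nat \<Rightarrow> bool" where
  "covered n F a \<longleftrightarrow> (\<exists>f. (\<forall>i<n. f i \<in> terms n) \<and> (\<forall>(s, t)\<in>F. (subst f s, subst f t) \<in> cong n a)
     \<and> (\<forall>i<n. \<exists>t\<in>terms n. (subst f t, Var i) \<in> cong n a))"

lemma subst_cong: "t \<in> terms n \<Longrightarrow> (\<And>i. i < n \<Longrightarrow> f i = g i) \<Longrightarrow> subst f t = subst g t"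
  by (induction t) auto

text \<open>Two terms have congruent images iff they share a value \<open>u\<close>, so evaluations
  alone express the condition. Only the values of \<open>f\<close> on the \<open>n\<close>
  generators matter, which lets one number \<open>z\<close> code the substitution.\<close>

lemma covered_iff_facts:
  assumes "F \<subseteq> terms n \<times> terms n"
  shows "covered n F a \<longleftrightarrow> (\<exists>z.
    (\<forall>r\<in>F. \<exists>u. hom_fact a z (term_code n (fst r)) u \<in> facts n \<and> hom_fact a z (term_code n (snd r)) u \<in> facts n)
    \<and> (\<forall>i\<in>{..<n}. \<exists>t. hom_fact a z t (Suc i) \<in> facts n))" (is "_ \<longleftrightarrow> (\<exists>z. ?P z \<and> ?Q z)")
proof -
  define e where "e z = (\<lambda>i. decode_term n (entry i z))" for z
  have P: "?P z \<longleftrightarrow> (\<forall>(s, t)\<in>F. (subst (e z) s, subst (e z) t) \<in> cong n a)" for z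
  proof -
    have "(\<exists>u. (subst (e z) s, decode_term n u) \<in> cong n a \<and> (subst (e z) t, decode_term n u) \<in> cong n a)
      \<longleftrightarrow> (subst (e z) s, subst (e z) t) \<in> cong n a" if "(s, t) \<in> F" for s t
    proof -
      have "subst (e z) t \<in> terms n" using that assms by (auto simp: e_def intro!: subst_terms)
      then show ?thesis
        by (metis cm_congruence.refl cm_congruence.sym cm_congruence.trans decode_term_code)
    qed
    then show ?thesis using assms by (fastforce simp: hom_fact_iff e_def[symmetric])
  qed
  have "(\<exists>t. (subst (e z) (decode_term n t), Var i) \<in> cong n a)
    \<longleftrightarrow> (\<exists>t\<in>terms n. (subst (e z) t, Var i) \<in> cong n a)" for z i
    by (metis decode_term_code decode_term_in)
  then have Q: "?Q z \<longleftrightarrow> (\<forall>i<n. \<exists>t\<in>terms n. (subst (e z) t, Var i) \<in> cong n a)" for z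
    by (simp add: hom_fact_iff e_def[symmetric] Ball_def)
  show ?thesis unfolding P Q covered_def
  proof (intro iffI; elim exE conjE)
    fix f assume f: "\<forall>i<n. f i \<in> terms n"
      and *: "\<forall>(s, t)\<in>F. (subst f s, subst f t) \<in> cong n a"
        "\<forall>i<n. \<exists>t\<in>terms n. (subst f t, Var i) \<in> cong n a"
    obtain z where "\<forall>i<n. entry i z = term_code n (f i)"
      using ex_entry[of n "\<lambda>i. term_code n (f i)"] by blast
    then have eq: "subst f t = subst (e z) t" if "t \<in> terms n" for t
      using that f by (intro subst_cong) (auto simp: e_def)
    have "\<forall>(s, t)\<in>F. (subst (e z) s, subst (e z) t) \<in> cong n a"
    proof clarify
      fix s t assume st: "(s, t) \<in> F"
      then have "s \<in> terms n" "t \<in> terms n" using assms by auto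
      moreover have "(subst f s, subst f t) \<in> cong n a" using *(1) st by blast
      ultimately show "(subst (e z) s, subst (e z) t) \<in> cong n a" by (simp add: eq)
    qed
    moreover have "\<forall>i<n. \<exists>t\<in>terms n. (subst (e z) t, Var i) \<in> cong n a"
      using *(2) by (simp flip: eq)
    ultimately show "\<exists>z. (\<forall>(s, t)\<in>F. (subst (e z) s, subst (e z) t) \<in> cong n a) \<and>
        (\<forall>i<n. \<exists>t\<in>terms n. (subst (e z) t, Var i) \<in> cong n a)"
      by blast
  next
    fix z assume "\<forall>(s, t)\<in>F. (subst (e z) s, subst (e z) t) \<in> cong n a"
      "\<forall>i<n. \<exists>t\<in>terms n. (subst (e z) t, Var i) \<in> cong n a"
    moreover have "\<forall>i<n. e z i \<in> terms n" by (simp add: e_def)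
    ultimately show "\<exists>f. (\<forall>i<n. f i \<in> terms n) \<and> (\<forall>(s, t)\<in>F. (subst f s, subst f t) \<in> cong n a)
     \<and> (\<forall>i<n. \<exists>t\<in>terms n. (subst f t, Var i) \<in> cong n a)" by blast
  qed
qed

lemma semidec_ex':
  assumes "semidec {x. P (pfst x) (psnd x)}" shows "semidec {x. \<exists>y. P x y}"
  using semidec_ex[OF assms] by simp

lemma semidec_hom_fact:
  assumes "computable a" "computable z" "computable t" "computable u"
  shows "semidec {x. hom_fact (a x) (z x) (t x) (u x) \<in> facts n}"
  using semidec_derivable[OF computable_fact_rules] unfolding hom_fact_def
  by (rule semidec_vimage) (intro computable_intros assms)

text \<open>Finiteness of \<open>F\<close> makes the condition on the relations a finite
  conjunction; the substitution, the shared values and the preimages of the generators are found by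
  search.\<close>

lemma semidec_covered:
  assumes "finite F" "F \<subseteq> terms n \<times> terms n"
  shows "semidec {a. covered n F a}"
  unfolding covered_iff_facts[OF assms(2)]
  by (intro semidec_ex' semidec_Ball assms(1) finite_lessThan
      semidec_Int[of "Collect P" "Collect Q" for P Q, folded Collect_conj_eq] semidec_hom_fact
      computable_intros)

section \<open>Congruences and quotient maps\<close>

lemma cm_congruence_mono: "R \<subseteq> R' \<Longrightarrow> cm_congruence n R \<subseteq> cm_congruence n R'"
proof
  fix x assume "R \<subseteq> R'" "x \<in> cm_congruence n R"
  then show "x \<in> cm_congruence n R'"
  proof (cases x)
    case (Pair s t)
    have "(s, t) \<in> cm_congruence n R \<Longrightarrow> R \<subseteq> R' \<Longrightarrow> (s, t) \<in> cm_congruence n R'"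
      by (induction rule: cm_congruence.induct) (blast intro: cm_congruence.intros)+
    then show ?thesis using Pair \<open>R \<subseteq> R'\<close> \<open>x \<in> cm_congruence n R\<close> by blast
  qed
qed

text \<open>Being a fixed point of generation says that \<open>K\<close> is a congruence whose
  quotient is a commutative monoid, and it turns the introduction rules into closure properties of
  \<open>K\<close> itself.\<close>

locale cm_cong =
  fixes n :: nat and K :: "(trm \<times> trm) set"
  assumes closed: "cm_congruence n K = K"
begin

lemma in_terms: "(s, t) \<in> K \<Longrightarrow> s \<in> terms n \<and> t \<in> terms n"
  using cm_congruence_terms[of s t n K] by (simp add: closed)

lemmas cong_refl = cm_congruence.refl[where n = n and R = K, unfolded closed]
lemmas cong_sym = cm_congruence.sym[where n = n and R = K, unfolded closed]
lemmas cong_trans [trans] = cm_congruence.trans[where n = n and R = K, unfolded closed]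
lemmas cong_times = cm_congruence.times[where n = n and R = K, unfolded closed]
lemmas cong_assoc = cm_congruence.assoc[where n = n and R = K, unfolded closed]
lemmas cong_comm = cm_congruence.comm[where n = n and R = K, unfolded closed]
lemmas cong_unit = cm_congruence.unit[where n = n and R = K, unfolded closed]

end

lemma cm_cong_congruence: "cm_cong n (cm_congruence n R)"
proof
  have "(s, t) \<in> cm_congruence n (cm_congruence n R) \<Longrightarrow> (s, t) \<in> cm_congruence n R" for s t
    by (induction rule: cm_congruence.induct) (blast intro: cm_congruence.intros)+
  then show "cm_congruence n (cm_congruence n R) = cm_congruence n R"
    by (auto intro: cm_congruence.base dest: cm_congruence_terms)
qed

lemma subst_subst: "subst g (subst f t) = subst (\<lambda>i. subst g (f i)) t"
  by (induction t) auto

text \<open>In other words, \<open>f\<close> induces a surjective homomorphism from the term algebra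
  onto the quotient by \<open>K\<close>.\<close>

definition covers :: "nat \<Rightarrow> (trm \<times> trm) set \<Rightarrow> (nat \<Rightarrow> trm) \<Rightarrow> bool" where
  "covers n K f \<longleftrightarrow> (\<forall>i<n. f i \<in> terms n) \<and> (\<forall>i<n. \<exists>t\<in>terms n. (subst f t, Var i) \<in> K)"

text \<open>The kernel of the homomorphism that \<open>f\<close> induces from the term algebra to
  the quotient by \<open>K\<close>.\<close>

definition pullback :: "nat \<Rightarrow> (trm \<times> trm) set \<Rightarrow> (nat \<Rightarrow> trm) \<Rightarrow> (trm \<times> trm) set" where
  "pullback n K f = {(s, t) \<in> terms n \<times> terms n. (subst f s, subst f t) \<in> K}"

context cm_cong
begin

lemma covers_term:
  assumes "covers n K f" "u \<in> terms n" shows "\<exists>t\<in>terms n. (subst f t, u) \<in> K"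
  using assms(2)
proof (induction u)
  case (Var i) then show ?case using assms(1) by (simp add: covers_def)
next
  case Unit show ?case using cong_refl[of Unit] by (intro bexI[of _ Unit]) auto
next
  case (Times u v)
  then obtain s t where "s \<in> terms n" "t \<in> terms n" "(subst f s, u) \<in> K" "(subst f t, v) \<in> K" by auto
  then show ?case using cong_times by (intro bexI[of _ "Times s t"]) auto
qed

lemma pullback:
  assumes "\<forall>i<n. f i \<in> terms n" shows "cm_cong n (pullback n K f)"
proof
  have sub: "t \<in> terms n \<Longrightarrow> subst f t \<in> terms n" for t using assms by (auto intro: subst_terms)
  have iff: "(s, t) \<in> pullback n K f \<longleftrightarrow> s \<in> terms n \<and> t \<in> terms n \<and> (subst f s, subst f t) \<in> K" for s t
    by (simp add: pullback_def)
  have "(s, t) \<in> cm_congruence n (pullback n K f) \<Longrightarrow> (s, t) \<in> pullback n K f" for s t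
  proof (induction rule: cm_congruence.induct)
    case (trans r s t)
    then show ?case unfolding iff using cong_trans by blast
  next
    case (sym s t)
    then show ?case unfolding iff using cong_sym by blast
  next
    case (times s s' t t')
    then show ?case unfolding iff by (simp add: cong_times)
  qed (simp_all add: iff sub cong_assoc cong_comm cong_unit cong_refl)
  then show "cm_congruence n (pullback n K f) = pullback n K f"
    by (auto simp: iff intro: cm_congruence.base)
qed

lemma covers_comp:
  assumes "covers n (pullback n K g) f" "covers n K g"
  shows "covers n K (\<lambda>i. subst g (f i))"
proof -
  interpret P: cm_cong n "pullback n K g" using assms(2) by (intro pullback) (simp add: covers_def)
  show ?thesis unfolding covers_def
  proof (intro conjI allI impI)
    fix i assume "i < n"
    show "subst g (f i) \<in> terms n"
      using assms \<open>i < n\<close> by (auto simp: covers_def intro: subst_terms)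
    obtain t where t: "t \<in> terms n" "(subst g t, Var i) \<in> K"
      using assms \<open>i < n\<close> by (auto simp: covers_def)
    moreover obtain s where "s \<in> terms n" "(subst f s, t) \<in> pullback n K g"
      using P.covers_term[OF assms(1) t(1)] by blast
    ultimately show "\<exists>t\<in>terms n. (subst (\<lambda>i. subst g (f i)) t, Var i) \<in> K"
      by (auto simp: pullback_def subst_subst intro: cong_trans)
  qed
qed

end

section \<open>Isomorphisms as substitutions\<close>

lemma equiv_class_cong_iff:
  "s \<in> terms n \<Longrightarrow> t \<in> terms n \<Longrightarrow> cong n a `` {s} = cong n a `` {t} \<longleftrightarrow> (s, t) \<in> cong n a"
  by (rule eq_equiv_class_iff[OF equiv_cm_congruence])

lemma carrier_CM_alg: "carrier (CM_alg n a) = (\<lambda>t. cong n a `` {t}) ` terms n"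
  by (auto simp: CM_alg_def Let_def quotient_def)

lemma one_CM_alg: "\<one>\<^bsub>CM_alg n a\<^esub> = cong n a `` {Unit}"
  by (simp add: CM_alg_def Let_def)

text \<open>Representatives of the images of the generators form the substitution. Surjectivity of
  the isomorphism gives \<open>covers\<close>, and injectivity identifies the kernel.\<close>

lemma CM_iso_imp_subst:
  assumes "CM_iso n b a"
  obtains f where "covers n (cong n a) f" "pullback n (cong n a) f = cong n b"
proof -
  obtain h where h: "h \<in> iso (CM_alg n b) (CM_alg n a)"
    using assms by (auto simp: CM_iso_def is_iso_def)
  then have hom: "h \<in> hom (CM_alg n b) (CM_alg n a)"
    and bij: "bij_betw h (carrier (CM_alg n b)) (carrier (CM_alg n a))"
    by (auto simp: iso_def)
  have "\<exists>u\<in>terms n. h (cong n b `` {Var i}) = cong n a `` {u}" if "i < n" for i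
    using hom_in_carrier[OF hom, of "cong n b `` {Var i}"] that by (auto simp: carrier_CM_alg)
  then obtain f where f: "\<And>i. i < n \<Longrightarrow> f i \<in> terms n"
    "\<And>i. i < n \<Longrightarrow> h (cong n b `` {Var i}) = cong n a `` {f i}" by metis
  have sub: "t \<in> terms n \<Longrightarrow> subst f t \<in> terms n" for t using f by (auto intro: subst_terms)
  have h_class: "t \<in> terms n \<Longrightarrow> h (cong n b `` {t}) = cong n a `` {subst f t}" for t
  proof (induction t)
    case Unit show ?case using iso_CM_alg_one[OF h] by (simp add: one_CM_alg)
  next
    case (Times s t)
    then have "h (cong n b `` {s} \<otimes>\<^bsub>CM_alg n b\<^esub> cong n b `` {t})
      = h (cong n b `` {s}) \<otimes>\<^bsub>CM_alg n a\<^esub> h (cong n b `` {t})"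
      by (intro hom_mult[OF hom]) (auto simp: carrier_CM_alg)
    then show ?case using Times by (simp add: CM_alg_mult sub)
  qed (simp add: f)
  show thesis
  proof (rule that)
    show "covers n (cong n a) f" unfolding covers_def
    proof (intro conjI allI impI)
      fix i assume i: "i < n"
      then have "cong n a `` {Var i} \<in> h ` carrier (CM_alg n b)"
        using bij by (auto simp: bij_betw_def carrier_CM_alg)
      then obtain t where "t \<in> terms n" "cong n a `` {subst f t} = cong n a `` {Var i}"
        by (auto simp: carrier_CM_alg h_class)
      then show "\<exists>t\<in>terms n. (subst f t, Var i) \<in> cong n a"
        using i by (auto simp: equiv_class_cong_iff sub)
    qed (use f in auto)
    have "(subst f s, subst f t) \<in> cong n a \<longleftrightarrow> (s, t) \<in> cong n b"
      if "s \<in> terms n" "t \<in> terms n" for s t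
    proof -
      have "h (cong n b `` {s}) = h (cong n b `` {t}) \<longleftrightarrow> cong n b `` {s} = cong n b `` {t}"
        using bij that by (intro inj_on_eq_iff[of h "carrier (CM_alg n b)"])
          (auto simp: bij_betw_def carrier_CM_alg)
      then show ?thesis using that by (simp add: h_class equiv_class_cong_iff sub)
    qed
    then show "pullback n (cong n a) f = cong n b"
      by (auto simp: pullback_def dest: cm_congruence_terms)
  qed
qed

text \<open>The first isomorphism theorem for the map induced by \<open>f\<close>.\<close>

lemma subst_imp_CM_iso:
  assumes cov: "covers n (cong n a) f" and eq: "pullback n (cong n a) f = cong n b"
  shows "CM_iso n b a"
proof -
  interpret A: cm_cong n "cong n a" by (rule cm_cong_congruence)
  have sub: "t \<in> terms n \<Longrightarrow> subst f t \<in> terms n" for t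
    using cov by (auto simp: covers_def intro: subst_terms)
  have iff: "(subst f s, subst f t) \<in> cong n a \<longleftrightarrow> (s, t) \<in> cong n b"
    if "s \<in> terms n" "t \<in> terms n" for s t
    unfolding eq[symmetric] using that by (simp add: pullback_def)
  \<comment> \<open>A class is mapped through an arbitrary representative; the condition on the
    kernel makes the choice immaterial.\<close>
  define h where "h A = cong n a `` {subst f (SOME t. t \<in> A)}" for A
  have h: "h (cong n b `` {t}) = cong n a `` {subst f t}" if t: "t \<in> terms n" for t
  proof -
    have "(SOME s. s \<in> cong n b `` {t}) \<in> cong n b `` {t}"
      unfolding some_in_eq using cm_congruence.refl[OF t] by auto
    then have "(t, SOME s. s \<in> cong n b `` {t}) \<in> cong n b"
      by (rule Image_singleton_iff[THEN iffD1])
    moreover from this have "(SOME s. s \<in> cong n b `` {t}) \<in> terms n"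
      by (blast dest: cm_congruence_terms)
    ultimately show ?thesis unfolding h_def using t
      by (subst equiv_class_cong_iff) (auto simp: sub iff intro: cm_congruence.sym)
  qed
  have "h \<in> hom (CM_alg n b) (CM_alg n a)"
  proof (rule homI)
    fix A B assume "A \<in> carrier (CM_alg n b)" "B \<in> carrier (CM_alg n b)"
    then obtain s t where "s \<in> terms n" "t \<in> terms n" "A = cong n b `` {s}" "B = cong n b `` {t}"
      by (auto simp: carrier_CM_alg)
    then show "h (A \<otimes>\<^bsub>CM_alg n b\<^esub> B) = h A \<otimes>\<^bsub>CM_alg n a\<^esub> h B"
      using h[of "Times s t"] by (simp add: h CM_alg_mult sub)
  qed (auto simp: carrier_CM_alg h sub)
  moreover have "inj_on h (carrier (CM_alg n b))"
  proof (rule inj_onI)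
    fix A B assume "A \<in> carrier (CM_alg n b)" "B \<in> carrier (CM_alg n b)" "h A = h B"
    then obtain s t where "s \<in> terms n" "t \<in> terms n" "A = cong n b `` {s}" "B = cong n b `` {t}"
      by (auto simp: carrier_CM_alg)
    then show "A = B" using \<open>h A = h B\<close> by (simp add: h equiv_class_cong_iff sub iff)
  qed
  moreover have "h ` carrier (CM_alg n b) = carrier (CM_alg n a)"
  proof
    show "carrier (CM_alg n a) \<subseteq> h ` carrier (CM_alg n b)"
    proof
      fix A assume "A \<in> carrier (CM_alg n a)"
      then obtain u where u: "u \<in> terms n" "A = cong n a `` {u}" by (auto simp: carrier_CM_alg)
      then obtain t where t: "t \<in> terms n" "(subst f t, u) \<in> cong n a"
        using A.covers_term[OF cov] by blast
      then have "A = h (cong n b `` {t})" using u by (simp add: h equiv_class_cong_iff sub A.cong_sym)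
      then show "A \<in> h ` carrier (CM_alg n b)" using t by (auto simp: carrier_CM_alg)
    qed
  qed (auto simp: carrier_CM_alg h sub)
  ultimately show ?thesis by (auto simp: CM_iso_def is_iso_def iso_def bij_betw_def)
qed

section \<open>Downsets of exponents\<close>

text \<open>Fix \<open>a\<close> in \<open>A\<close>. A vector of \<open>A\<close> not above
  \<open>a\<close> has some coordinate \<open>i\<close> with a value \<open>j < a i\<close>. There
  are finitely many such slices, and within each one the coordinate \<open>i\<close> is constant, so
  induction applies to \<open>I - {i}\<close>.\<close>

lemma dickson:
  fixes A :: "('i \<Rightarrow> nat) set"
  assumes "finite I"
  shows "\<exists>B\<subseteq>A. finite B \<and> (\<forall>v\<in>A. \<exists>b\<in>B. \<forall>i\<in>I. b i \<le> v i)"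
  using assms
proof (induction I arbitrary: A rule: finite_psubset_induct)
  case (psubset I)
  show ?case
  proof (cases "A = {}")
    case False
    then obtain a where a: "a \<in> A" by blast
    define good where "good i j B \<longleftrightarrow> B \<subseteq> {v \<in> A. v i = j} \<and> finite B \<and>
      (\<forall>v\<in>{v \<in> A. v i = j}. \<exists>b\<in>B. \<forall>k\<in>I - {i}. b k \<le> v k)" for i j B
    define B where "B i j = (SOME B. good i j B)" for i j
    have good: "good i j (B i j)" if "i \<in> I" for i j
    proof -
      have "\<exists>B. good i j B" unfolding good_def by (rule psubset.IH) (use that in auto)
      then show ?thesis unfolding B_def by (rule someI_ex)
    qed
    have B: "B i j \<subseteq> {v \<in> A. v i = j}" "finite (B i j)"
      "v \<in> A \<Longrightarrow> v i = j \<Longrightarrow> \<exists>b\<in>B i j. \<forall>k\<in>I - {i}. b k \<le> v k" if "i \<in> I" for i j v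
      using good[OF that, of j] unfolding good_def by blast+
    define C where "C = insert a (\<Union>i\<in>I. \<Union>j<a i. B i j)"
    show ?thesis
    proof (intro exI[of _ C] conjI ballI)
      show "C \<subseteq> A" "finite C"
        using a B(1,2) psubset.hyps by (auto simp: C_def)
      fix v assume v: "v \<in> A"
      show "\<exists>b\<in>C. \<forall>i\<in>I. b i \<le> v i"
      proof (cases "\<forall>i\<in>I. a i \<le> v i")
        case True then show ?thesis by (auto simp: C_def)
      next
        case False
        then obtain i where i: "i \<in> I" "v i < a i" by force
        then obtain b where b: "b \<in> B i (v i)" "\<forall>k\<in>I - {i}. b k \<le> v k"
          using B(3)[OF i(1) v] by blast
        then have "b i = v i" using B(1)[OF i(1)] by blast
        then have "\<forall>k\<in>I. b k \<le> v k" using b(2) by (metis DiffI order_refl singletonD)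
        moreover have "b \<in> C" using b(1) i by (auto simp: C_def)
        ultimately show ?thesis by blast
      qed
    qed
  qed auto
qed

definition vecs :: "nat \<Rightarrow> (nat \<Rightarrow> nat) set" where
  "vecs n = {v. \<forall>i\<ge>n. v i = 0}"

definition downset :: "nat \<Rightarrow> (nat \<Rightarrow> nat) set \<Rightarrow> bool" where
  "downset n D \<longleftrightarrow> D \<subseteq> vecs n \<and> (\<forall>v\<in>D. \<forall>w. w \<le> v \<longrightarrow> w \<in> D)"

lemma vecs_mono:
  assumes "v \<in> vecs n" "w \<le> v" shows "w \<in> vecs n"
proof -
  have "w i = 0" if "n \<le> i" for i
    using assms that le_funD[OF assms(2), of i] by (simp add: vecs_def)
  then show ?thesis by (simp add: vecs_def)
qed

lemma vecs_le_iff: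
  assumes "v \<in> vecs n" shows "v \<le> w \<longleftrightarrow> (\<forall>i<n. v i \<le> w i)"
proof
  assume *: "\<forall>i<n. v i \<le> w i"
  have "v i \<le> w i" for i using assms * by (cases "i < n") (auto simp: vecs_def)
  then show "v \<le> w" by (rule le_funI)
qed (simp add: le_fun_def)

text \<open>By Dickson's lemma, finitely many vectors outside \<open>D\<close> witness all
  non-membership. If \<open>m\<close> bounds their coordinates, then a vector above one of them
  stays above it after capping at \<open>m\<close>.\<close>

lemma downset_truncation:
  assumes "downset n D"
  shows "\<exists>m. \<forall>v\<in>vecs n. (\<lambda>i. min (v i) m) \<in> D \<longrightarrow> v \<in> D"
proof -
  obtain B where B: "B \<subseteq> vecs n - D" "finite B"
    "\<And>v. v \<in> vecs n - D \<Longrightarrow> \<exists>b\<in>B. \<forall>i\<in>{..<n}. b i \<le> v i"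
    using dickson[of "{..<n}" "vecs n - D"] by auto
  define m where "m = Max (insert 0 (\<Union>b\<in>B. b ` {..<n}))"
  have m: "b i \<le> m" if "b \<in> B" "i < n" for b i
    unfolding m_def using that B(2) by (intro Max_ge) auto
  have "v \<in> D" if v: "v \<in> vecs n" "(\<lambda>i. min (v i) m) \<in> D" for v
  proof (rule ccontr)
    assume "v \<notin> D"
    then obtain b where b: "b \<in> B" "\<forall>i\<in>{..<n}. b i \<le> v i" using B(3) v by blast
    then have "b \<le> (\<lambda>i. min (v i) m)"
      using B(1) m by (subst vecs_le_iff[of b n]) auto
    then have "b \<in> D" using assms v(2) by (auto simp: downset_def)
    then show False using b B(1) by blast
  qed
  then show ?thesis by blast
qed

section \<open>The lexicographic order and exponent vectors\<close>

definition lex_less :: "nat \<Rightarrow> (nat \<Rightarrow> nat) \<Rightarrow> (nat \<Rightarrow> nat) \<Rightarrow> bool" where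
  "lex_less n v w \<longleftrightarrow> (\<exists>i<n. v i < w i \<and> (\<forall>j<i. v j = w j))"

lemma lex_less_add: "lex_less n v w \<Longrightarrow> lex_less n (\<lambda>i. v i + u i) (\<lambda>i. w i + u i)"
  unfolding lex_less_def by auto

lemma lex_less_linear:
  assumes "v \<in> vecs n" "w \<in> vecs n" "\<not> lex_less n v w" "\<not> lex_less n w v"
  shows "v = w"
proof (rule ccontr)
  assume "v \<noteq> w"
  then obtain k where k: "v k \<noteq> w k" by blast
  define i where "i = (LEAST i. v i \<noteq> w i)"
  have i: "v i \<noteq> w i" unfolding i_def using k by (rule LeastI)
  have "v j = w j" if "j < i" for j using not_less_Least that unfolding i_def by blast
  moreover have "i < n" using assms i unfolding vecs_def by (metis (mono_tags, lifting) mem_Collect_eq not_less)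
  ultimately show False using assms i unfolding lex_less_def by (metis nat_neq_iff)
qed

text \<open>The coordinates are minimised one after another, each among the vectors that agree with
  the earlier choice on the coordinates before it.\<close>

lemma lex_less_minimal:
  assumes "A \<noteq> {}" shows "\<exists>v\<in>A. \<forall>w\<in>A. \<not> lex_less n w v"
proof (induction n)
  case 0 then show ?case using assms by (auto simp: lex_less_def)
next
  case (Suc n)
  then obtain v where v: "v \<in> A" "\<forall>w\<in>A. \<not> lex_less n w v" by blast
  define P where "P w \<longleftrightarrow> w \<in> A \<and> (\<forall>j<n. w j = v j)" for w
  have "P v" using v by (simp add: P_def)
  then obtain u where u: "P u" "\<And>w. P w \<Longrightarrow> u n \<le> w n"
    using ex_has_least_nat[of P v "\<lambda>w. w n"] by blast
  have "\<not> lex_less (Suc n) w u" if "w \<in> A" for w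
  proof
    assume "lex_less (Suc n) w u"
    then obtain i where i: "i < Suc n" "w i < u i" "\<forall>j<i. w j = u j" by (auto simp: lex_less_def)
    show False
    proof (cases "i = n")
      case True
      then have "P w" using i u(1) that by (auto simp: P_def)
      then show False using u(2) i True by fastforce
    next
      case False
      then have "i < n" using i by simp
      then have "lex_less n w v" using i u(1) unfolding lex_less_def P_def by (intro exI[of _ i]) auto
      then show False using v that by blast
    qed
  qed
  then show ?case using u(1) P_def by blast
qed

primrec exponent :: "trm \<Rightarrow> nat \<Rightarrow> nat" where
  "exponent (Var i) = (\<lambda>j. if j = i then 1 else 0)"
| "exponent Unit = (\<lambda>j. 0)"
| "exponent (Times s t) = (\<lambda>j. exponent s j + exponent t j)"

lemma exponent_vecs: "t \<in> terms n \<Longrightarrow> exponent t \<in> vecs n"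
  by (induction t) (auto simp: vecs_def)

lemma exponent_eq_0_iff: "exponent t i = 0 \<longleftrightarrow> i \<notin> vars t"
  by (induction t) auto

lemma ex_exponent: "v \<in> vecs n \<Longrightarrow> \<exists>t\<in>terms n. exponent t = v"
proof (induction "\<Sum>i<n. v i" arbitrary: v rule: less_induct)
  case less
  show ?case
  proof (cases "\<exists>i<n. v i > 0")
    case True
    then obtain i where i: "i < n" "v i > 0" by blast
    define w where "w = v(i := v i - 1)"
    have "w \<in> vecs n" using less.prems by (auto simp: vecs_def w_def)
    moreover have "(\<Sum>i<n. w i) < (\<Sum>i<n. v i)"
      using i by (intro sum_strict_mono_ex1) (auto simp: w_def)
    ultimately obtain t where t: "t \<in> terms n" "exponent t = w" using less.hyps by blast
    have "exponent (Times (Var i) t) = v" using i by (auto simp: t w_def)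
    then show ?thesis using t i by (intro bexI[of _ "Times (Var i) t"]) auto
  next
    case False
    then have "v = exponent Unit" using less.prems by (auto simp: vecs_def not_less)
    then show ?thesis by (intro bexI[of _ Unit]) auto
  qed
qed

context cm_cong
begin

lemma unit_right: "t \<in> terms n \<Longrightarrow> (Times t Unit, t) \<in> K"
  using cong_trans[OF cong_comm cong_unit] by simp

lemma left_comm:
  assumes "r \<in> terms n" "s \<in> terms n" "t \<in> terms n"
  shows "(Times r (Times s t), Times s (Times r t)) \<in> K"
proof -
  have "(Times r (Times s t), Times (Times r s) t) \<in> K" using assms by (intro cong_sym[OF cong_assoc])
  also have "(Times (Times r s) t, Times (Times s r) t) \<in> K"
    using assms by (intro cong_times cong_comm cong_refl)
  also have "(Times (Times s r) t, Times s (Times r t)) \<in> K" using assms by (intro cong_assoc)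
  finally show ?thesis .
qed

lemma extract_var:
  "t \<in> terms n \<Longrightarrow> i \<in> vars t \<Longrightarrow>
    \<exists>s\<in>terms n. (t, Times (Var i) s) \<in> K \<and> exponent t = exponent (Times (Var i) s)"
proof (induction t)
  case (Var j)
  then show ?case using unit_right[of "Var j"] cong_sym by (intro bexI[of _ Unit]) auto
next
  case (Times t1 t2)
  then have T: "t1 \<in> terms n" "t2 \<in> terms n" "i < n" by (auto simp: terms_def)
  then have V: "Var i \<in> terms n" by simp
  show ?case
  proof (cases "i \<in> vars t1")
    case True
    then obtain s where s: "s \<in> terms n" "(t1, Times (Var i) s) \<in> K"
      "exponent t1 = exponent (Times (Var i) s)" using Times by auto
    have "(Times t1 t2, Times (Times (Var i) s) t2) \<in> K" using s T by (intro cong_times cong_refl)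
    also have "(Times (Times (Var i) s) t2, Times (Var i) (Times s t2)) \<in> K"
      using s T V by (intro cong_assoc)
    finally show ?thesis using s T by (intro bexI[of _ "Times s t2"]) (auto simp: ac_simps)
  next
    case False
    then obtain s where s: "s \<in> terms n" "(t2, Times (Var i) s) \<in> K"
      "exponent t2 = exponent (Times (Var i) s)" using Times by auto
    have "(Times t1 t2, Times t1 (Times (Var i) s)) \<in> K" using s T by (intro cong_times cong_refl)
    also have "(Times t1 (Times (Var i) s), Times (Var i) (Times t1 s)) \<in> K"
      using s T V by (intro left_comm)
    finally show ?thesis using s T by (intro bexI[of _ "Times t1 s"]) (auto simp: ac_simps)
  qed
qed simp

lemma no_vars: "t \<in> terms n \<Longrightarrow> vars t = {} \<Longrightarrow> (t, Unit) \<in> K"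
proof (induction t)
  case (Times s t)
  then have "(Times s t, Times Unit Unit) \<in> K" by (intro cong_times) auto
  also have "(Times Unit Unit, Unit) \<in> K" by (intro cong_unit) simp
  finally show ?case .
qed (auto intro: cong_refl)

text \<open>The free commutative monoid is \<open>\<nat>\<^sup>n\<close>: by induction on the
  degree, a common variable is pulled to the front of both terms and cancelled from the
  exponents.\<close>

lemma exponent_eq_imp:
  "s \<in> terms n \<Longrightarrow> t \<in> terms n \<Longrightarrow> exponent s = exponent t \<Longrightarrow> (s, t) \<in> K"
proof (induction "\<Sum>i<n. exponent s i" arbitrary: s t rule: less_induct)
  case less
  have "vars s = vars t"
    using exponent_eq_0_iff[of s] exponent_eq_0_iff[of t] less.prems(3) by auto
  show ?case
  proof (cases "vars s = {}")
    case True
    then show ?thesis using no_vars less.prems \<open>vars s = vars t\<close> cong_sym cong_trans by metis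
  next
    case False
    then obtain i where i: "i \<in> vars s" "i \<in> vars t" using \<open>vars s = vars t\<close> by blast
    then have "i < n" using less.prems by (auto simp: terms_def)
    obtain s' where s: "s' \<in> terms n" "(s, Times (Var i) s') \<in> K"
      "exponent s = exponent (Times (Var i) s')" using extract_var i less.prems by blast
    obtain t' where t: "t' \<in> terms n" "(t, Times (Var i) t') \<in> K"
      "exponent t = exponent (Times (Var i) t')" using extract_var i less.prems by blast
    have eq: "exponent s' = exponent t'"
    proof
      fix j show "exponent s' j = exponent t' j" using less.prems(3) fun_cong[OF s(3), of j] fun_cong[OF t(3), of j]
        by simp
    qed
    have "(\<Sum>j<n. exponent s' j) < (\<Sum>j<n. exponent s j)"
      using \<open>i < n\<close> by (intro sum_strict_mono_ex1) (auto simp: s(3))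
    then have "(s', t') \<in> K" using less.hyps s t eq by blast
    then have "(Times (Var i) s', Times (Var i) t') \<in> K" using \<open>i < n\<close> by (intro cong_times cong_refl) auto
    then show ?thesis using s(2) t(2) cong_sym cong_trans by metis
  qed
qed

end

section \<open>Standard monomials and finite generation\<close>

definition min_terms :: "nat \<Rightarrow> (trm \<times> trm) set \<Rightarrow> trm set" where
  "min_terms n K = {t \<in> terms n. \<forall>s. (s, t) \<in> K \<longrightarrow> \<not> lex_less n (exponent s) (exponent t)}"

text \<open>The standard monomials of the binomial ideal of \<open>K\<close>.\<close>

definition standard :: "nat \<Rightarrow> (trm \<times> trm) set \<Rightarrow> (nat \<Rightarrow> nat) set" where
  "standard n K = exponent ` min_terms n K"

lemma standard_antimono: "K \<subseteq> K' \<Longrightarrow> standard n K' \<subseteq> standard n K"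
  unfolding standard_def min_terms_def by blast

context cm_cong
begin

lemma min_terms_iff: "t \<in> terms n \<Longrightarrow> t \<in> min_terms n K \<longleftrightarrow> exponent t \<in> standard n K"
proof
  assume t: "t \<in> terms n" "exponent t \<in> standard n K"
  then obtain s where s: "s \<in> min_terms n K" "exponent s = exponent t" by (auto simp: standard_def)
  then have "(t, s) \<in> K" using t by (intro exponent_eq_imp) (auto simp: min_terms_def)
  then show "t \<in> min_terms n K" using s t cong_trans by (auto simp: min_terms_def)
qed (simp add: standard_def)

lemma ex_min_term:
  assumes "t \<in> terms n" shows "\<exists>s\<in>min_terms n K. (s, t) \<in> K"
proof -
  have "exponent ` {s. (s, t) \<in> K} \<noteq> {}" using cong_refl assms by blast
  from lex_less_minimal[OF this, of n]
  obtain s where s: "(s, t) \<in> K" "\<And>r. (r, t) \<in> K \<Longrightarrow> \<not> lex_less n (exponent r) (exponent s)" by auto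
  then have "s \<in> min_terms n K"
    using in_terms cong_trans by (auto simp: min_terms_def)
  then show ?thesis using s by blast
qed

lemma min_terms_unique:
  assumes "s \<in> min_terms n K" "t \<in> min_terms n K" "(s, t) \<in> K"
  shows "exponent s = exponent t"
  using assms cong_sym by (intro lex_less_linear[of _ n]) (auto simp: min_terms_def intro: exponent_vecs)

text \<open>The order is compatible with multiplication: a smaller term congruent to a divisor,
  multiplied by the cofactor, would give a smaller term congruent to the standard term.\<close>

lemma downset_standard: "downset n (standard n K)"
  unfolding downset_def
proof (intro conjI ballI allI impI)
  show "standard n K \<subseteq> vecs n" by (auto simp: standard_def min_terms_def intro: exponent_vecs)
  fix v w :: "nat \<Rightarrow> nat" assume v: "v \<in> standard n K" and le: "w \<le> v"
  then have "v \<in> vecs n" using \<open>standard n K \<subseteq> vecs n\<close> by blast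
  moreover have "(\<lambda>i. v i - w i) \<le> v" by (simp add: le_fun_def)
  ultimately have V: "w \<in> vecs n" "(\<lambda>i. v i - w i) \<in> vecs n" using le by (auto intro: vecs_mono)
  then obtain s r t where t: "t \<in> min_terms n K" "exponent t = v"
    and s: "s \<in> terms n" "exponent s = w" and r: "r \<in> terms n" "exponent r = (\<lambda>i. v i - w i)"
    using v ex_exponent[OF V(1)] ex_exponent[OF V(2)] unfolding standard_def by blast
  have sum: "exponent (Times s r) = v" using le by (simp add: s r le_fun_def)
  then have m: "Times s r \<in> min_terms n K" using v s r by (simp add: min_terms_iff)
  have "\<not> lex_less n (exponent s') (exponent s)" if "(s', s) \<in> K" for s'
  proof
    assume "lex_less n (exponent s') (exponent s)"
    then have "lex_less n (exponent (Times s' r)) (exponent (Times s r))" by (simp add: lex_less_add)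
    moreover have "(Times s' r, Times s r) \<in> K" using that r by (intro cong_times cong_refl)
    ultimately show False using m by (auto simp: min_terms_def)
  qed
  then show "w \<in> standard n K" using s by (auto simp: standard_def min_terms_def)
qed

text \<open>Minimal terms are normal forms. If those of \<open>K'\<close> stay minimal for
  \<open>K\<close>, then \<open>K\<close> identifies two of them only when their exponents agree.
  Hence a properly larger congruence loses a standard monomial.\<close>

lemma standard_subset_imp:
  assumes "cm_cong n K'" "K' \<subseteq> K" "standard n K' \<subseteq> standard n K"
  shows "K \<subseteq> K'"
proof
  interpret K': cm_cong n K' by fact
  fix x assume "x \<in> K"
  then obtain s t where x: "x = (s, t)" "(s, t) \<in> K" by (cases x) auto
  then have st: "s \<in> terms n" "t \<in> terms n" using in_terms by auto
  obtain u v where u: "u \<in> min_terms n K'" "(u, s) \<in> K'" and v: "v \<in> min_terms n K'" "(v, t) \<in> K'"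
    using K'.ex_min_term st by meson
  then have T: "u \<in> terms n" "v \<in> terms n" by (auto simp: min_terms_def)
  then have "u \<in> min_terms n K" "v \<in> min_terms n K"
    using u v assms(3) K'.min_terms_iff min_terms_iff by blast+
  moreover have "(u, v) \<in> K" using u v x assms(2) cong_trans cong_sym by (meson subsetD)
  ultimately have "exponent u = exponent v" by (rule min_terms_unique)
  then have "(u, v) \<in> K'" using T by (intro K'.exponent_eq_imp)
  then show "x \<in> K'" using u v x K'.cong_trans K'.cong_sym by metis
qed

text \<open>Redei's theorem.\<close>

lemma finitely_generated: "\<exists>F\<subseteq>K. finite F \<and> cm_congruence n F = K"
proof -
  define S where "S F = standard n (cm_congruence n F)" for F
  have S_down: "downset n (S F)" for F
    unfolding S_def by (intro cm_cong.downset_standard cm_cong_congruence)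
  have S_anti: "F \<subseteq> F' \<Longrightarrow> S F' \<subseteq> S F" for F F'
    unfolding S_def by (intro standard_antimono cm_congruence_mono)
  \<comment> \<open>All monomials made nonstandard by finitely many relations of \<open>K\<close>.
    Dickson's lemma yields one finite \<open>F\<close> that makes every one of them
    nonstandard.\<close>
  define U where "U = (\<Union>F\<in>{F. F \<subseteq> K \<and> finite F}. vecs n - S F)"
  obtain B where B: "B \<subseteq> U" "finite B" "\<And>v. v \<in> U \<Longrightarrow> \<exists>b\<in>B. \<forall>i\<in>{..<n}. b i \<le> v i"
    using dickson[of "{..<n}" U] by auto
  have "\<forall>b\<in>B. \<exists>F. F \<subseteq> K \<and> finite F \<and> b \<notin> S F" using B(1) unfolding U_def by blast
  then obtain G where G: "\<And>b. b \<in> B \<Longrightarrow> G b \<subseteq> K \<and> finite (G b) \<and> b \<notin> S (G b)" by metis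
  define F where "F = (\<Union>b\<in>B. G b)"
  have F: "F \<subseteq> K" "finite F" using G B(2) by (auto simp: F_def)
  have disj: "v \<notin> S F" if vU: "v \<in> U" for v
  proof
    assume v: "v \<in> S F"
    obtain b where b: "b \<in> B" "\<forall>i\<in>{..<n}. b i \<le> v i" using B(3)[OF vU] by blast
    then have "b \<in> vecs n" using B(1) by (auto simp: U_def)
    then have "b \<le> v" using b(2) by (simp add: vecs_le_iff)
    then have "b \<in> S F" using S_down v by (auto simp: downset_def)
    moreover have "S F \<subseteq> S (G b)" using b(1) by (intro S_anti) (auto simp: F_def)
    ultimately show False using G b(1) by blast
  qed
  have "x \<in> cm_congruence n F" if "x \<in> K" for x
  proof -
    have F': "insert x F \<subseteq> K" "finite (insert x F)" using F that by auto
    \<comment> \<open>A standard monomial lost by adding \<open>x\<close> would lie in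
      \<open>U\<close>, where \<open>F\<close> has already left nothing standard.\<close>
    have "S F \<subseteq> S (insert x F)"
    proof
      fix v assume v: "v \<in> S F"
      then have "v \<in> vecs n" using S_down by (auto simp: downset_def)
      then show "v \<in> S (insert x F)" using F' disj v unfolding U_def by blast
    qed
    then have "cm_congruence n (insert x F) \<subseteq> cm_congruence n F"
      unfolding S_def
      by (rule cm_cong.standard_subset_imp[OF cm_cong_congruence cm_cong_congruence
            cm_congruence_mono[OF subset_insertI]])
    moreover have "x \<in> cm_congruence n (insert x F)"
    proof (cases x)
      case (Pair s t)
      then show ?thesis using in_terms[of s t] that by (simp add: cm_congruence.base)
    qed
    ultimately show ?thesis by blast
  qed
  moreover have "cm_congruence n F \<subseteq> K" using cm_congruence_mono[OF F(1), of n] by (simp only: closed)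
  ultimately show ?thesis using F by blast
qed

end

section \<open>Descent along ordinals\<close>

definition orthant :: "nat set \<Rightarrow> (nat \<Rightarrow> nat) \<Rightarrow> (nat \<Rightarrow> nat) set" where
  "orthant S u = {v. (\<forall>i\<in>S. u i \<le> v i) \<and> (\<forall>i. i \<notin> S \<longrightarrow> v i = u i)}"

definition has_orthant :: "nat \<Rightarrow> nat \<Rightarrow> (nat \<Rightarrow> nat) set \<Rightarrow> bool" where
  "has_orthant n k X \<longleftrightarrow> (\<exists>S u. S \<subseteq> {..<n} \<and> card S = k \<and> orthant S u \<subseteq> X)"

lemma orthant_self: "u \<in> orthant S u"
  by (simp add: orthant_def)

lemma finite_cells: "finite {v \<in> vecs n. \<forall>i. v i \<le> m}"
proof -
  have "{v \<in> vecs n. \<forall>i. v i \<le> m} \<subseteq> {v. \<forall>i. (i \<in> {..<n} \<longrightarrow> v i \<in> {..m}) \<and> (i \<notin> {..<n} \<longrightarrow> v i = 0)}"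
    by (auto simp: vecs_def)
  then show ?thesis by (rule finite_subset) (intro finite_set_of_finite_funs; simp)
qed

text \<open>
  Far out, a \<open>k\<close>-orthant in \<open>D - D0\<close> runs inside a single cell \<open>{v. min v m = c}\<close> of \<open>D\<close>, where
  exactly \<open>k\<close> coordinates of \<open>c\<close> are \<open>m\<close>; two orthants running inside the same cell meet.
\<close>

lemma card_disjoint_orthants:
  assumes D: "downset n D" "\<forall>v\<in>vecs n. (\<lambda>i. min (v i) m) \<in> D \<longrightarrow> v \<in> D"
    and D0: "downset n D0"
    and small: "\<not> has_orthant n (Suc k) (D - D0)"
    and Z: "\<And>S u. (S, u) \<in> Z \<Longrightarrow> S \<subseteq> {..<n} \<and> card S = k \<and> orthant S u \<subseteq> D - D0"
    and disj: "\<And>S u S' u'. (S, u) \<in> Z \<Longrightarrow> (S', u') \<in> Z \<Longrightarrow> (S, u) \<noteq> (S', u')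
      \<Longrightarrow> orthant S u \<inter> orthant S' u' = {}"
  shows "card Z \<le> card {v \<in> vecs n. \<forall>i. v i \<le> m}"
proof -
  define cell :: "nat set \<times> (nat \<Rightarrow> nat) \<Rightarrow> nat \<Rightarrow> nat" where "cell = (\<lambda>(S, u) i. if i \<in> S then m else min (u i) m)"
  \<comment> \<open>Otherwise the orthant could be widened in direction \<open>i\<close>: once its
    coordinates in \<open>insert i S\<close> are at least \<open>m\<close>, raising them further
    stays in \<open>D\<close> by the choice of \<open>m\<close>, and it stays outside the downset
    \<open>D0\<close>. That contradicts \<open>small\<close>.\<close>
  have outside: "u i < m" if Su: "(S, u) \<in> Z" and i: "i < n" "i \<notin> S" for S u i
  proof (rule ccontr)
    assume "\<not> u i < m"
    define p where "p j = (if j \<in> S then max (u j) m else u j)" for j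
    have S: "S \<subseteq> {..<n}" "card S = k" "orthant S u \<subseteq> D - D0" using Z[OF Su] by auto
    have "p \<in> orthant S u" by (auto simp: p_def orthant_def)
    then have p: "p \<in> D" "p \<notin> D0" using S by auto
    have pm: "m \<le> p j" if "j \<in> insert i S" for j
      using that \<open>\<not> u i < m\<close> i by (auto simp: p_def)
    have "orthant (insert i S) p \<subseteq> D - D0"
    proof
      fix v assume v: "v \<in> orthant (insert i S) p"
      then have le: "p \<le> v" unfolding orthant_def le_fun_def
        by (metis (mono_tags, lifting) mem_Collect_eq order_refl)
      have "v j = 0" if "n \<le> j" for j
      proof -
        have "j \<notin> insert i S" using that S(1) i by auto
        then have "v j = p j" using v by (simp add: orthant_def)
        also have "\<dots> = 0" using p D(1) that by (auto simp: downset_def vecs_def)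
        finally show ?thesis .
      qed
      then have "v \<in> vecs n" by (simp add: vecs_def)
      moreover have "(\<lambda>j. min (v j) m) \<le> p"
      proof (rule le_funI)
        fix j show "min (v j) m \<le> p j"
        proof (cases "j \<in> insert i S")
          case True then show ?thesis using pm by (meson min.cobounded2 order.trans)
        next
          case False then show ?thesis using v by (simp add: orthant_def)
        qed
      qed
      then have "(\<lambda>j. min (v j) m) \<in> D" using D(1) p(1) by (auto simp: downset_def)
      ultimately have "v \<in> D" using D(2) by blast
      moreover have "v \<notin> D0" using D0 p(2) le by (auto simp: downset_def)
      ultimately show "v \<in> D - D0" by blast
    qed
    moreover have "card (insert i S) = Suc k" using S i finite_subset[OF S(1)] by simp
    ultimately show False using small S i unfolding has_orthant_def
      by (metis insert_subset lessThan_iff)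
  qed
  have "inj_on cell Z"
  proof (rule inj_onI, clarify)
    fix S u S' u' assume Su: "(S, u) \<in> Z" and Su': "(S', u') \<in> Z" and eq: "cell (S, u) = cell (S', u')"
    have sub: "S \<subseteq> {..<n}" "S' \<subseteq> {..<n}" using Z Su Su' by auto
    have cell_outside: "cell (T, w) i = w i" if "(T, w) \<in> Z" "i < n" "i \<notin> T" for T w i
      using outside[OF that] that(3) by (simp add: cell_def)
    \<comment> \<open>The free directions can be read off the cell as the coordinates equal to
      \<open>m\<close>.\<close>
    have cell_m: "T = {i. i < n \<and> cell (T, w) i = m}" if Tw: "(T, w) \<in> Z" for T w
    proof -
      have "i \<in> T \<longleftrightarrow> cell (T, w) i = m" if "i < n" for i
        using outside[OF Tw that] cell_outside[OF Tw that] by (cases "i \<in> T") (auto simp: cell_def)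
      then show ?thesis using Z[OF Tw] by auto
    qed
    have "S = S'" using cell_m[OF Su] cell_m[OF Su'] eq by simp
    have "u i = u' i" if "i \<notin> S" for i
    proof (cases "i < n")
      case True
      then show ?thesis
        using fun_cong[OF eq, of i] that cell_outside[OF Su] cell_outside[OF Su'] \<open>S = S'\<close> by simp
    next
      case False
      have "u \<in> vecs n" "u' \<in> vecs n"
        using Z[OF Su] Z[OF Su'] orthant_self[of u S] orthant_self[of u' S'] D(1)
        unfolding downset_def by blast+
      then show ?thesis using False by (simp add: vecs_def)
    qed
    \<comment> \<open>Equal cells give equal directions and equal fixed coordinates, so taking
      maxima in the free directions produces a common point.\<close>
    then have "(\<lambda>i. if i \<in> S then max (u i) (u' i) else u i) \<in> orthant S u \<inter> orthant S' u'"
      using \<open>S = S'\<close> by (auto simp: orthant_def)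
    then have "(S, u) = (S', u')" using disj[OF Su Su'] by blast
    then show "S = S' \<and> u = u'" by simp
  qed
  moreover have "cell ` Z \<subseteq> {v \<in> vecs n. \<forall>i. v i \<le> m}"
  proof (rule image_subsetI)
    fix x assume "x \<in> Z"
    moreover obtain S u where x: "x = (S, u)" by (cases x)
    ultimately have Su: "(S, u) \<in> Z" by simp
    have S: "S \<subseteq> {..<n}" and "u \<in> D" using Z[OF Su] orthant_self[of u S] by auto
    then have "u i = 0" if "n \<le> i" for i using D(1) that by (auto simp: downset_def vecs_def)
    moreover have "i \<notin> S" if "n \<le> i" for i using S that by auto
    ultimately show "cell x \<in> {v \<in> vecs n. \<forall>i. v i \<le> m}"
      by (simp add: x cell_def vecs_def)
  qed
  ultimately show ?thesis by (rule card_inj_on_le[OF _ _ finite_cells])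
qed

lemma lex_less_thanI:
  "x < y \<Longrightarrow> length xs = length ys \<Longrightarrow> (a @ x # xs, a @ y # ys) \<in> lex less_than"
  by (auto simp: lex_conv)

text \<open>
  The list \<open>a @ x # replicate k 0\<close> is read as the ordinal \<open>\<delta> = \<alpha> + \<omega>\<^sup>k x\<close>. Passing from
  \<open>\<delta> + \<omega>\<^sup>k\<close> to \<open>\<delta>\<close> costs a \<open>k\<close>-dimensional set: for \<open>k + 1\<close>, first
  go to \<open>\<delta> + \<omega>\<^sup>k N\<close> for a large \<open>N\<close> chosen after \<open>D\<close>, and then lose \<open>N\<close> disjoint
  \<open>k\<close>-orthants.
\<close>

lemma orthant_lost:
  assumes down: "\<And>l D. D \<in> \<rho> l \<Longrightarrow> downset n D"
    and dec: "\<And>l l' D. length l = Suc n \<Longrightarrow> (l', l) \<in> lex less_than \<Longrightarrow> D \<in> \<rho> l \<Longrightarrow> \<exists>D'\<in>\<rho> l'. D' \<subset> D"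
    and "length a + k = n" "D \<in> \<rho> (a @ Suc x # replicate k 0)"
  shows "\<exists>D'\<in>\<rho> (a @ x # replicate k 0). D' \<subseteq> D \<and> has_orthant n k (D - D')"
  using assms(3,4)
proof (induction k arbitrary: a x D)
  case 0
  have "(a @ [x], a @ [Suc x]) \<in> lex less_than" by (rule lex_less_thanI) auto
  then obtain D' where D': "D' \<in> \<rho> (a @ [x])" "D' \<subset> D"
    using 0 dec[of "a @ [Suc x]" "a @ [x]" D] by auto
  then obtain u where "u \<in> D - D'" by blast
  moreover have "orthant {} u = {u}" by (auto simp: orthant_def)
  ultimately have "has_orthant n 0 (D - D')" unfolding has_orthant_def
    by (intro exI[of _ "{}"] exI[of _ u]) simp
  then show ?case using D' by auto
next
  case (Suc k)
  note orthant_step = Suc.IH and len = Suc.prems(1)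
  have "downset n D" using down Suc.prems by blast
  then obtain m where m: "\<forall>v\<in>vecs n. (\<lambda>i. min (v i) m) \<in> D \<longrightarrow> v \<in> D"
    using downset_truncation by blast
  \<comment> \<open>One more than the number of cells, so that \<open>N\<close> disjoint orthants
    cannot all fit by \<open>card_disjoint_orthants\<close>.\<close>
  define N where "N = Suc (card {v \<in> vecs n. \<forall>i. v i \<le> m})"
  have "(a @ x # N # replicate k 0, a @ Suc x # 0 # replicate k 0) \<in> lex less_than"
    by (rule lex_less_thanI) auto
  then obtain E where E: "E \<in> \<rho> ((a @ [x]) @ N # replicate k 0)" "E \<subset> D"
    using Suc.prems dec[of "a @ Suc x # 0 # replicate k 0" "a @ x # N # replicate k 0" D] by auto
  \<comment> \<open>Counting \<open>c\<close> down to \<open>0\<close> loses one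
    \<open>k\<close>-orthant per step. They are disjoint because each comes from the difference of
    successive downsets in a decreasing chain.\<close>
  have "\<exists>D'\<in>\<rho> ((a @ [x]) @ 0 # replicate k 0). D' \<subseteq> E \<and> (\<exists>Z. finite Z \<and> card Z = c \<and>
      (\<forall>(S, u)\<in>Z. S \<subseteq> {..<n} \<and> card S = k \<and> orthant S u \<subseteq> E - D') \<and>
      (\<forall>(S, u)\<in>Z. \<forall>(S', u')\<in>Z. (S, u) \<noteq> (S', u') \<longrightarrow> orthant S u \<inter> orthant S' u' = {}))"
    if "E \<in> \<rho> ((a @ [x]) @ c # replicate k 0)" for c E
    using that
  proof (induction c arbitrary: E)
    case 0
    then show ?case by (intro bexI[of _ E]) (auto intro!: exI[of _ "{}"])
  next
    case (Suc c)
    obtain E' where E': "E' \<in> \<rho> ((a @ [x]) @ c # replicate k 0)" "E' \<subseteq> E" "has_orthant n k (E - E')"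
      using orthant_step[of "a @ [x]" E c] Suc.prems len by auto
    obtain D' Z where D': "D' \<in> \<rho> ((a @ [x]) @ 0 # replicate k 0)" "D' \<subseteq> E'" and Z: "finite Z" "card Z = c"
      "\<forall>(S, u)\<in>Z. S \<subseteq> {..<n} \<and> card S = k \<and> orthant S u \<subseteq> E' - D'"
      "\<forall>(S, u)\<in>Z. \<forall>(S', u')\<in>Z. (S, u) \<noteq> (S', u') \<longrightarrow> orthant S u \<inter> orthant S' u' = {}"
      using Suc.IH(1)[OF E'(1)] by blast
    obtain S u where S: "S \<subseteq> {..<n}" "card S = k" "orthant S u \<subseteq> E - E'"
      using E'(3) by (auto simp: has_orthant_def)
    have new: "orthant S u \<inter> orthant S' u' = {}" if "(S', u') \<in> Z" for S' u'
      using bspec[OF Z(3) that] S(3) by auto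
    have "(S, u) \<notin> Z" using new[of S u] orthant_self[of u S] by blast
    then have "card (insert (S, u) Z) = Suc c" using Z by simp
    moreover have "\<forall>(S', u')\<in>insert (S, u) Z. S' \<subseteq> {..<n} \<and> card S' = k \<and> orthant S' u' \<subseteq> E - D'"
      using S Z(3) D'(2) E'(2) by (auto simp: subset_iff)
    moreover have "\<forall>(S1, u1)\<in>insert (S, u) Z. \<forall>(S2, u2)\<in>insert (S, u) Z.
        (S1, u1) \<noteq> (S2, u2) \<longrightarrow> orthant S1 u1 \<inter> orthant S2 u2 = {}"
      using Z(4) new by (simp add: Int_commute) (use new in blast)
    ultimately show ?case using D' E'(2) Z(1)
      by (intro bexI[of _ D'] conjI exI[of _ "insert (S, u) Z"]) auto
  qed
  from this[OF E(1)] obtain D' Z where D': "D' \<in> \<rho> ((a @ [x]) @ 0 # replicate k 0)" "D' \<subseteq> E"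
    and Z: "finite Z" "card Z = N" "\<forall>(S, u)\<in>Z. S \<subseteq> {..<n} \<and> card S = k \<and> orthant S u \<subseteq> E - D'"
      "\<forall>(S, u)\<in>Z. \<forall>(S', u')\<in>Z. (S, u) \<noteq> (S', u') \<longrightarrow> orthant S u \<inter> orthant S' u' = {}"
    by blast
  have "has_orthant n (Suc k) (D - D')"
  proof (rule ccontr)
    assume small: "\<not> has_orthant n (Suc k) (D - D')"
    have "card Z \<le> card {v \<in> vecs n. \<forall>i. v i \<le> m}"
    proof (rule card_disjoint_orthants[OF \<open>downset n D\<close> m down[OF D'(1)] small])
      fix S u assume Su: "(S, u) \<in> Z"
      show "S \<subseteq> {..<n} \<and> card S = k \<and> orthant S u \<subseteq> D - D'"
        using bspec[OF Z(3) Su] E(2) by auto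
      fix S' u' assume Su': "(S', u') \<in> Z" and neq: "(S, u) \<noteq> (S', u')"
      have "\<forall>(S', u')\<in>Z. (S, u) \<noteq> (S', u') \<longrightarrow> orthant S u \<inter> orthant S' u' = {}"
        using bspec[OF Z(4) Su] by simp
      from bspec[OF this Su'] neq show "orthant S u \<inter> orthant S' u' = {}" by simp
    qed
    then show False using Z(2) by (simp add: N_def)
  qed
  then show ?case using D' E(2) by (intro bexI[of _ D']) auto
qed

text \<open>Descending from \<open>\<omega>\<^sup>n\<close> to \<open>0\<close> loses an orthant in
  all \<open>n\<close> directions. A downset that contains a translate of
  \<open>\<nat>\<^sup>n\<close> is everything.\<close>

lemma omega_pow_downset:
  assumes "\<And>l D. D \<in> \<rho> l \<Longrightarrow> downset n D"
    and "\<And>l l' D. length l = Suc n \<Longrightarrow> (l', l) \<in> lex less_than \<Longrightarrow> D \<in> \<rho> l \<Longrightarrow> \<exists>D'\<in>\<rho> l'. D' \<subset> D"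
    and "D \<in> \<rho> (omega_pow n)"
  shows "D = vecs n"
proof
  show "D \<subseteq> vecs n" using assms(1)[OF assms(3)] by (simp add: downset_def)
  \<comment> \<open>With the empty prefix and \<open>x = 0\<close>, the starting list is
    \<open>omega_pow n\<close>.\<close>
  obtain D' where "has_orthant n n (D - D')"
    using orthant_lost[of \<rho> n "[]" n D 0] assms by (auto simp: omega_pow_def)
  then obtain S u where S: "S \<subseteq> {..<n}" "card S = n" "orthant S u \<subseteq> D"
    by (auto simp: has_orthant_def)
  then have "S = {..<n}" by (simp add: card_subset_eq)
  have "u \<in> vecs n" using S(3) orthant_self \<open>D \<subseteq> vecs n\<close> by blast
  show "vecs n \<subseteq> D"
  proof
    fix v assume "v \<in> vecs n"
    then have "(\<lambda>i. v i + u i) \<in> orthant S u"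
      using \<open>S = {..<n}\<close> by (auto simp: orthant_def vecs_def)
    then have "(\<lambda>i. v i + u i) \<in> D" using S by blast
    moreover have "v \<le> (\<lambda>i. v i + u i)" by (simp add: le_fun_def)
    ultimately show "v \<in> D" using assms(1)[OF assms(3)] unfolding downset_def by blast
  qed
qed

section \<open>Reductions and proper quotients\<close>

lemma covers_mono: "covers n C f \<Longrightarrow> C \<subseteq> C' \<Longrightarrow> covers n C' f"
  unfolding covers_def by blast

lemma pullback_comp:
  assumes "\<forall>i<n. f i \<in> terms n"
  shows "pullback n C (\<lambda>i. subst g (f i)) = pullback n (pullback n C g) f"
  using assms by (auto simp: pullback_def subst_subst intro: subst_terms)

text \<open>Composing \<open>f\<close> with \<open>g\<close> presents both quotients on the same
  generators, where their kernels, and hence their standard monomials, can be compared.\<close>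

lemma proper_quotient_standard:
  assumes "cm_cong n C" "cm_cong n C'" and f: "covers n C f" and g: "covers n C' g"
    and less: "C \<subset> pullback n C' g"
  shows "\<exists>f'. covers n C' f' \<and> standard n (pullback n C' f') \<subset> standard n (pullback n C f)"
proof (intro exI[of _ "\<lambda>i. subst g (f i)"] conjI psubsetI notI)
  interpret C: cm_cong n C by fact
  interpret C': cm_cong n C' by fact
  define P where "P = pullback n C' g"
  interpret P: cm_cong n P unfolding P_def using g by (intro C'.pullback) (simp add: covers_def)
  have K': "pullback n C' (\<lambda>i. subst g (f i)) = pullback n P f"
    unfolding P_def using f by (intro pullback_comp) (simp add: covers_def)
  have K_cong: "cm_cong n (pullback n C f)" using f by (intro C.pullback) (simp add: covers_def)
  interpret K': cm_cong n "pullback n P f" using f by (intro P.pullback) (simp add: covers_def)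
  have sub: "pullback n C f \<subseteq> pullback n P f" using less by (auto simp: pullback_def P_def)
  show "covers n C' (\<lambda>i. subst g (f i))"
    using covers_mono[OF f] less by (intro C'.covers_comp g) auto
  show "standard n (pullback n C' (\<lambda>i. subst g (f i))) \<subseteq> standard n (pullback n C f)"
    unfolding K' by (rule standard_antimono) (rule sub)
  assume "standard n (pullback n C' (\<lambda>i. subst g (f i))) = standard n (pullback n C f)"
  then have eq: "pullback n P f \<subseteq> pullback n C f"
    unfolding K' by (intro K'.standard_subset_imp K_cong sub) simp
  \<comment> \<open>Strictness survives the pullback because \<open>f\<close> is onto: any pair in
    \<open>P\<close> lifts along \<open>f\<close>, where the two kernels would agree.\<close>
  have "P \<subseteq> C"
  proof
    fix x assume "x \<in> P"
    then obtain s t where x: "x = (s, t)" "(s, t) \<in> P" by (cases x) auto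
    then have "s \<in> terms n" "t \<in> terms n" using P.in_terms by auto
    then obtain s0 t0 where T: "s0 \<in> terms n" "t0 \<in> terms n"
      and s0: "(subst f s0, s) \<in> C" and t0: "(subst f t0, t) \<in> C"
      using C.covers_term[OF f] by meson
    have "(subst f s0, s) \<in> P" "(t, subst f t0) \<in> P"
      using s0 C.cong_sym[OF t0] less unfolding P_def by blast+
    then have "(subst f s0, subst f t0) \<in> P" using x(2) P.cong_trans by blast
    then have "(subst f s0, subst f t0) \<in> C" using eq T by (auto simp: pullback_def)
    then show "x \<in> C" using x(1) C.cong_trans[OF C.cong_sym[OF s0] C.cong_trans[OF _ t0]] by simp
  qed
  then show False using less unfolding P_def by blast
qed

text \<open>
  The program \<open>e'\<close> enumerates \<open>W e\<close>, and it adds \<open>g\<close> as soon as it finds a surjective homomorphism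
  from the algebra of \<open>r e\<close> onto the algebra of its own image \<open>r e'\<close>. It must find one, since
  otherwise these two algebras would be isomorphic.
\<close>

lemma reduction_proper_quotient:
  assumes r: "computable r" and We: "semidec (W e)"
    and same: "\<And>e'. W e' = W e \<Longrightarrow> CM_iso n (r e) (r e')"
    and more: "\<And>e'. W e' = insert g (W e) \<Longrightarrow> CM_iso n (r e') (r d)"
    and differ: "\<not> CM_iso n (r e) (r d)"
  shows "\<exists>f. covers n (cong n (r d)) f \<and> cong n (r e) \<subset> pullback n (cong n (r d)) f"
proof -
  \<comment> \<open>A finite set of relations is what makes the search for a surjection
    semidecidable.\<close>
  obtain F where F: "F \<subseteq> cong n (r e)" "finite F" "cm_congruence n F = cong n (r e)"
    using cm_cong.finitely_generated[OF cm_cong_congruence] by blast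
  have "cong n (r e) \<subseteq> terms n \<times> terms n" by (auto dest: cm_congruence_terms)
  with F(1) have F_terms: "F \<subseteq> terms n \<times> terms n" by (rule subset_trans)
  have "semidec {a. covered n F a}" using F(2) F_terms by (rule semidec_covered)
  then have "semidec {y. r (pfst y) \<in> {a. covered n F a}}"
    by (rule semidec_vimage) (intro computable_comp[OF r] computable_intros)
  moreover have "semidec {y. psnd y \<in> W e}" "semidec {y. psnd y \<in> {g}}"
    by (intro semidec_vimage We semidec_singleton computable_intros)+
  ultimately have "semidec ({y. psnd y \<in> W e} \<union> ({y. psnd y \<in> {g}} \<inter> {y. r (pfst y) \<in> {a. covered n F a}}))"
    by (intro semidec_Un semidec_Int)
  then obtain e' where "W e' = {x. prod_encode (e', x) \<in>
      {y. psnd y \<in> W e} \<union> ({y. psnd y \<in> {g}} \<inter> {y. r (pfst y) \<in> {a. covered n F a}})}"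
    by (rule recursion_theorem)
  then have e': "W e' = W e \<union> {x. x = g \<and> covered n F (r e')}" by auto
  have "covered n F (r e')"
  proof (rule ccontr)
    assume not: "\<not> covered n F (r e')"
    then have "CM_iso n (r e) (r e')" using e' by (intro same) auto
    then obtain f where f: "covers n (cong n (r e')) f" "pullback n (cong n (r e')) f = cong n (r e)"
      by (rule CM_iso_imp_subst)
    then have "(subst f s, subst f t) \<in> cong n (r e')" if "(s, t) \<in> F" for s t
      using that F(1) by (auto simp: pullback_def)
    then show False using not f(1) unfolding covered_def covers_def by blast
  qed
  then obtain f where f: "covers n (cong n (r e')) f"
    and F_f: "\<And>s t. (s, t) \<in> F \<Longrightarrow> (subst f s, subst f t) \<in> cong n (r e')"
    unfolding covered_def covers_def by blast
  have "W e' = insert g (W e)" using e' \<open>covered n F (r e')\<close> by auto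
  then obtain g' where g': "covers n (cong n (r d)) g'" "pullback n (cong n (r d)) g' = cong n (r e')"
    using CM_iso_imp_subst[OF more] by blast
  \<comment> \<open>The surjection onto the algebra of \<open>r e'\<close>, followed by the
    isomorphism to that of \<open>r d\<close>.\<close>
  define k where "k i = subst g' (f i)" for i
  have k: "covers n (cong n (r d)) k"
    unfolding k_def using f g' by (intro cm_cong.covers_comp cm_cong_congruence) auto
  have pk: "pullback n (cong n (r d)) k = pullback n (cong n (r e')) f"
    unfolding k_def g'(2)[symmetric] using f by (intro pullback_comp) (simp add: covers_def)
  have "cm_cong n (pullback n (cong n (r d)) k)"
    using k by (intro cm_cong.pullback cm_cong_congruence) (simp add: covers_def)
  moreover have "F \<subseteq> pullback n (cong n (r d)) k"
    unfolding pk using F_f F_terms by (auto simp: pullback_def)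
  ultimately have "cong n (r e) \<subseteq> pullback n (cong n (r d)) k"
    using cm_congruence_mono[of F "pullback n (cong n (r d)) k" n] F(3) by (simp add: cm_cong_def)
  \<comment> \<open>Equality would turn \<open>k\<close> into an isomorphism between inequivalent
    algebras.\<close>
  moreover have "cong n (r e) \<noteq> pullback n (cong n (r d)) k"
    using differ subst_imp_CM_iso[OF k, of "r e"] by auto
  ultimately show ?thesis using k by blast
qed

section \<open>Ordinals up to \<open>\<omega>\<^sup>n\<close> as lists of fixed length\<close>

lemma lex_replicate_0: "(c, replicate m 0) \<notin> lex less_than"
  by (induction m arbitrary: c) (auto simp: Cons_in_lex elim!: list.set_cases, case_tac c, auto)

text \<open>The lists of length \<open>n + 1\<close> standing for the ordinals \<open>\<le> \<omega>\<^sup>n\<close>, with leading zeros allowed.\<close>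

definition padded :: "nat \<Rightarrow> nat list set" where
  "padded n = {l. length l = Suc n \<and> (l = omega_pow n \<or> hd l = 0)}"

definition strip :: "nat list \<Rightarrow> nat list" where
  "strip = dropWhile (\<lambda>x. x = 0)"

lemma padded_lex:
  assumes "l \<in> padded n" "(l', l) \<in> lex less_than" shows "l' \<in> padded n"
proof -
  have len: "length l' = Suc n" using assms by (auto simp: padded_def lex_conv)
  then obtain x xs y ys where l: "l' = x # xs" "l = y # ys" using assms by (cases l; cases l') (auto simp: padded_def)
  have "y = 0 \<or> y = 1 \<and> ys = replicate n 0" using assms(1) l by (auto simp: padded_def omega_pow_def)
  then have "x = 0" using assms(2) l lex_replicate_0[of xs n] by auto
  then show ?thesis using len l by (simp add: padded_def)
qed

lemma strip_padded:
  assumes "l \<in> padded n" shows "strip l \<in> ord_below (ord_succ (omega_pow n))"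
proof -
  have below: "ord_below (ord_succ (omega_pow n)) = insert (omega_pow n) {b. cnf b \<and> length b \<le> n}"
    using ord_below_succ[of "omega_pow n"] ord_below_omega_pow by (simp add: cnf_def omega_pow_def)
  show ?thesis
  proof (cases "l = omega_pow n")
    case True
    then show ?thesis unfolding below by (simp add: strip_def omega_pow_def)
  next
    case False
    then obtain ys where "l = 0 # ys" "length ys = n"
      using assms by (cases l) (auto simp: padded_def)
    then have "length (strip l) \<le> n" using length_dropWhile_le[of _ ys] by (simp add: strip_def)
    moreover have "cnf (strip l)" unfolding cnf_def strip_def
      using hd_dropWhile[of "\<lambda>x. x = 0" l] by (metis dropWhile_eq_Nil_conv not_gr0)
    ultimately show ?thesis unfolding below by simp
  qed
qed

text \<open>Stripping leading zeros leaves a list whose length records the leading power, and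
  \<open>lenlex\<close> compares lengths first.\<close>

lemma strip_less: "(l', l) \<in> lex less_than \<Longrightarrow> ord_less (strip l') (strip l)"
proof (induction l arbitrary: l')
  case (Cons y ys)
  then obtain x xs where l': "l' = x # xs" by (cases l') auto
  have len: "length xs = length ys" using Cons.prems l' by (auto simp: lex_conv)
  consider "x < y" | "x = y" "(xs, ys) \<in> lex less_than" using Cons.prems l' by auto
  then show ?case
  proof cases
    case 1
    show ?thesis
    proof (cases "x = 0")
      case True
      then have "length (strip l') \<le> length xs" using length_dropWhile_le[of _ xs] by (simp add: strip_def l')
      then show ?thesis using 1 len by (simp add: ord_less_def lenlex_conv strip_def l')
    next
      case False
      then show ?thesis using 1 len by (simp add: ord_less_def lenlex_conv strip_def l')
    qed
  next
    case 2
    show ?thesis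
    proof (cases "x = 0")
      case True
      then show ?thesis using Cons.IH[OF 2(2)] 2 by (simp add: strip_def l')
    next
      case False
      then show ?thesis using 2 len by (simp add: ord_less_def lenlex_conv strip_def l')
    qed
  qed
qed simp

lemma ord_less_irrefl: "\<not> ord_less b b"
  unfolding ord_less_def using wf_lenlex[OF wf_less_than] by (rule wf_not_refl)

theorem theorem4p11:
  fixes n :: nat and h :: "nat list \<Rightarrow> nat"
  assumes "n \<ge> 1"
    and "computable_coding (ord_succ (omega_pow n)) h"
  shows "\<not> (E_min (ord_succ (omega_pow n)) h \<le>\<^sub>c CM_iso n)"
proof
  let ?a = "ord_succ (omega_pow n)"
  assume "E_min ?a h \<le>\<^sub>c CM_iso n"
  then obtain r where r: "computable r" and red: "\<And>x y. E_min ?a h x y \<longleftrightarrow> CM_iso n (r x) (r y)"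
    unfolding creducible_def by blast
  have inj: "inj_on h (ord_below ?a)"
    using assms(2) by (simp add: computable_coding_def bij_betw_def)
  have le: "coded_le ?a h (h b) (h c) \<longleftrightarrow> b = c \<or> ord_less b c"
    if "b \<in> ord_below ?a" "c \<in> ord_below ?a" for b c
    using that inj by (simp add: coded_le_def)
  obtain e0 where e0: "W e0 = {}" by (rule semidec_W[OF semidec_empty])
  have "\<exists>e. W e = {h (strip l)}" for l
    using semidec_W[OF semidec_singleton] by blast
  then obtain e where e: "\<And>l. W (e l) = {h (strip l)}" by metis
  have E_single: "E_min ?a h x (e l) \<longleftrightarrow> least_elem ?a h (W x) (h (strip l))" if "l \<in> padded n" for x l
    using le strip_padded[OF that] by (auto simp: E_min_def least_elem_def e)
  define C where "C l = cong n (r (e l))" for l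
  have C: "cm_cong n (C l)" for l unfolding C_def by (rule cm_cong_congruence)
  define \<rho> where "\<rho> l = (if l \<in> padded n then {standard n (pullback n (C l) f) | f. covers n (C l) f} else {})" for l
  have down: "downset n D" if "D \<in> \<rho> l" for D l
    using that unfolding \<rho>_def
    by (auto split: if_splits simp: covers_def intro!: cm_cong.downset_standard cm_cong.pullback C)
  have dec: "\<exists>D'\<in>\<rho> l'. D' \<subset> D" if lex: "(l', l) \<in> lex less_than" and D: "D \<in> \<rho> l" for l l' D
  proof -
    have l: "l \<in> padded n" using D by (auto simp: \<rho>_def split: if_splits)
    then have l': "l' \<in> padded n" using lex by (rule padded_lex)
    have less: "ord_less (strip l') (strip l)" using lex by (rule strip_less)
    have "\<exists>g. covers n (cong n (r (e l'))) g \<and> cong n (r (e l)) \<subset> pullback n (cong n (r (e l'))) g"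
    proof (rule reduction_proper_quotient[OF r, where g = "h (strip l')"])
      show "semidec (W (e l))" by (simp add: e semidec_singleton)
      show "CM_iso n (r (e l)) (r e')" if "W e' = W (e l)" for e'
        unfolding red[symmetric] using that le strip_padded[OF l] by (auto simp: E_min_def least_elem_def e)
      \<comment> \<open>Once enumerated, the smaller ordinal is the least element, so such an
        \<open>e'\<close> is equivalent to \<open>e l'\<close>.\<close>
      show "CM_iso n (r e') (r (e l'))" if "W e' = insert (h (strip l')) (W (e l))" for e'
        unfolding red[symmetric] E_single[OF l'] least_elem_def that e
        using le strip_padded[OF l] strip_padded[OF l'] less by simp
      show "\<not> CM_iso n (r (e l)) (r (e l'))"
        unfolding red[symmetric] E_single[OF l'] least_elem_def e
        using inj_on_eq_iff[OF inj strip_padded[OF l'] strip_padded[OF l]] less ord_less_irrefl by auto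
    qed
    then obtain g where "covers n (C l') g" "C l \<subset> pullback n (C l') g" unfolding C_def by blast
    then show ?thesis
      using proper_quotient_standard[OF C C, of l f l' g for f] D l l' by (fastforce simp: \<rho>_def)
  qed
  have top: "omega_pow n \<in> padded n" by (simp add: padded_def omega_pow_def)
  \<comment> \<open>The empty set acts as one more point above \<open>\<omega>\<^sup>n\<close>,
    since enumerating that ordinal leads from the one to the other.\<close>
  have "\<exists>g. covers n (cong n (r (e (omega_pow n)))) g \<and>
      cong n (r e0) \<subset> pullback n (cong n (r (e (omega_pow n)))) g"
  proof (rule reduction_proper_quotient[OF r, where g = "h (strip (omega_pow n))"])
    show "semidec (W e0)" by (simp add: e0 semidec_empty)
    show "CM_iso n (r e0) (r e')" if "W e' = W e0" for e'
      unfolding red[symmetric] using that by (simp add: E_min_def e0)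
    show "CM_iso n (r e') (r (e (omega_pow n)))" if "W e' = insert (h (strip (omega_pow n))) (W e0)" for e'
      unfolding red[symmetric] E_single[OF top] least_elem_def that e0
      using le strip_padded[OF top] by simp
    show "\<not> CM_iso n (r e0) (r (e (omega_pow n)))"
      unfolding red[symmetric] E_single[OF top] least_elem_def e0 by simp
  qed
  then obtain g where g: "covers n (C (omega_pow n)) g" "cong n (r e0) \<subset> pullback n (C (omega_pow n)) g"
    unfolding C_def by blast
  \<comment> \<open>The identity substitution presents the algebra of \<open>r e0\<close> on its own
    generators.\<close>
  have var: "covers n (cong n (r e0)) Var"
    unfolding covers_def by (auto intro!: bexI[of _ "Var i" for i] cm_congruence.refl)
  obtain D where D: "D \<in> \<rho> (omega_pow n)" "D \<subset> standard n (pullback n (cong n (r e0)) Var)"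
    using proper_quotient_standard[OF cm_cong_congruence C var g] top by (auto simp: \<rho>_def)
  \<comment> \<open>The descent already forces all of \<open>\<nat>\<^sup>n\<close> at
    \<open>\<omega>\<^sup>n\<close>, so no strictly larger set of standard monomials exists.\<close>
  have "D = vecs n" by (rule omega_pow_downset[of \<rho>]) (use down dec D(1) in auto)
  moreover have "standard n (pullback n (cong n (r e0)) Var) \<subseteq> vecs n"
    by (auto simp: standard_def min_terms_def intro: exponent_vecs)
  ultimately show False using D(2) by blast
qed

end
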